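(* Let $1<p<\infty$. Assume that $I$ is an ideal in $N^p$ generated by inner functions $\varphi_1,\ldots,\varphi_n$, and suppose that $I$ contains an interpolating Blaschke product $B$ with zeros $\{z_k\}_{k\ge 1}$ such that $$\sum_{k=1}^\infty\big(1-|z_k|^2\big)\Big|\log\big(|\varphi_1(z_k)|+\cdots+|\varphi_n(z_k)|\big)\Big|^p<\infty.$$ Then $I=N^p$.
   Context: $D$ is the open unit disk in $\mathbb{C}$. $H^\infty$ is the ring of bounded holomorphic functions on $D$. For $1<p<\infty$, $N^p$ is the algebra (under pointwise operations) of holomorphic $f$ on $D$ with $\sup_{0<r<1}\int_0^{2\pi}\big(\log^+|f(re^{i\theta})|\big)^p\,\frac{d\theta}{2\pi}<\infty$, where $\log^+ x=\max(\log x,0)$ for $x\ge 0$ (so $\log^+0=0$). An inner function is a product of a Blaschke product and a singular inner function (up to a unimodular constant: a bounded holomorphic function on $D$ whose radial limits have modulus $1$ a.e. on $\partial D$). A sequence $\{z_k\}\subset D$ is an interpolating sequence (for $H^\infty$) if for every bounded sequence $\{\omega_k\}$ of complex numbers there exists $f\in H^\infty$ with $f(z_k)=\omega_k$ for every $k$. An interpolating Blaschke product is a Blaschke product whose (simple) zeros form an interpolating sequence. Convention: $|\log 0|=+\infty$, so finiteness of the sum includes that $|\varphi_1(z_k)|+\cdots+|\varphi_n(z_k)|>0$ for every $k$. *)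

theory Defs
  imports "HOL-Complex_Analysis.Complex_Analysis" "HOL-Algebra.Ideal"
begin

abbreviation unit_disc :: "complex set"
  where "unit_disc \<equiv> ball 0 1"

text \<open>
  A function on the disc is an extensional function \<^typ>\<open>complex \<Rightarrow> complex\<close>, i.e. one that is
  \<^const>\<open>undefined\<close> off the disc, so that equality of functions is equality on the disc.
\<close>

definition Hinf :: "(complex \<Rightarrow> complex) set"
  where "Hinf = {f \<in> extensional unit_disc. f holomorphic_on unit_disc \<and> bounded (f ` unit_disc)}"

text \<open>Since \<^prop>\<open>ln (0::real) = 0\<close> in the library, this yields the value \<^term>\<open>0::real\<close> at \<^term>\<open>0::real\<close>.\<close>

definition log_plus :: "real \<Rightarrow> real"
  where "log_plus x = max (ln x) 0"

definition log_plus_mean :: "real \<Rightarrow> (complex \<Rightarrow> complex) \<Rightarrow> real \<Rightarrow> real"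
  where "log_plus_mean p f r =
    integral {0..2 * pi} (\<lambda>t. log_plus (cmod (f (of_real r * cis t))) powr p / (2 * pi))"

definition Np_carrier :: "real \<Rightarrow> (complex \<Rightarrow> complex) set"
  where "Np_carrier p = {f \<in> extensional unit_disc. f holomorphic_on unit_disc \<and>
    bdd_above (log_plus_mean p f ` {0<..<1})}"

definition Np :: "real \<Rightarrow> (complex \<Rightarrow> complex) ring"
  where "Np p = \<lparr>carrier = Np_carrier p,
    mult = (\<lambda>f g. \<lambda>z\<in>unit_disc. f z * g z), one = (\<lambda>z\<in>unit_disc. 1),
    zero = (\<lambda>z\<in>unit_disc. 0), add = (\<lambda>f g. \<lambda>z\<in>unit_disc. f z + g z)\<rparr>"

definition inner_function :: "(complex \<Rightarrow> complex) \<Rightarrow> bool"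
  where "inner_function f \<longleftrightarrow> f \<in> Hinf \<and>
    (AE t in lborel. t \<in> {0..2 * pi} \<longrightarrow>
      (\<exists>L. cmod L = 1 \<and> ((\<lambda>r. f (of_real r * cis t)) \<longlongrightarrow> L) (at_left 1)))"

text \<open>
  Sequences of points are indexed by a set \<open>K\<close> of natural numbers: infinite \<open>K\<close> (such as
  \<open>{1..}\<close>) for infinite sequences, finite \<open>K\<close> for finite ones.
\<close>

definition interpolating_sequence :: "nat set \<Rightarrow> (nat \<Rightarrow> complex) \<Rightarrow> bool"
  where "interpolating_sequence K z \<longleftrightarrow> z ` K \<subseteq> unit_disc \<and>
    (\<forall>\<omega> :: nat \<Rightarrow> complex. bounded (\<omega> ` K) \<longrightarrow> (\<exists>f\<in>Hinf. \<forall>k\<in>K. f (z k) = \<omega> k))"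

definition blaschke_factor :: "complex \<Rightarrow> complex \<Rightarrow> complex"
  where "blaschke_factor a w =
    (if a = 0 then w else of_real (cmod a) / a * ((a - w) / (1 - cnj a * w)))"

text \<open>
  The zeros are listed with multiplicity. The condition on \<^term>\<open>1 - cmod (z k)\<close> makes the
  product converge at every point of the disc. A unimodular constant factor is permitted.
\<close>

definition blaschke_product :: "nat set \<Rightarrow> (nat \<Rightarrow> complex) \<Rightarrow> (complex \<Rightarrow> complex) \<Rightarrow> bool"
  where "blaschke_product K z B \<longleftrightarrow> z ` K \<subseteq> unit_disc \<and> (\<lambda>k. 1 - cmod (z k)) summable_on K \<and>
    (\<exists>c. cmod c = 1 \<and>
      B = (\<lambda>w\<in>unit_disc. c * (\<Prod>k. if k \<in> K then blaschke_factor (z k) w else 1)))"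

text \<open>An interpolating sequence is injective on its index set, so the zeros below are simple.\<close>

definition interpolating_blaschke_product ::
    "nat set \<Rightarrow> (nat \<Rightarrow> complex) \<Rightarrow> (complex \<Rightarrow> complex) \<Rightarrow> bool"
  where "interpolating_blaschke_product K z B \<longleftrightarrow>
    blaschke_product K z B \<and> interpolating_sequence K z"

lemma interpolating_sequence_inj_on:
  assumes "interpolating_sequence K z"
  shows "inj_on z K"
proof (rule inj_onI)
  fix i j assume ij: "i \<in> K" "j \<in> K" "z i = z j"
  have "bounded ((\<lambda>k. if k = i then 1 else 0 :: complex) ` K)"
    by (rule finite_imp_bounded, rule finite_subset[of _ "{0, 1}"]) auto
  then obtain f where "\<forall>k\<in>K. f (z k) = (if k = i then 1 else 0 :: complex)"
    using assms unfolding interpolating_sequence_def by blast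
  with ij show "i = j" by (metis zero_neq_one)
qed

text \<open>
  \<^const>\<open>genideal\<close> is an intersection of ideals, hence meaningful only over a ring; the rest of
  the theory shows that \<^const>\<open>Np\<close> is one.
\<close>

lemma log_plus_nonneg [simp]: "0 \<le> log_plus x"
  by (simp add: log_plus_def)

lemma log_plus_mono: "0 \<le> x \<Longrightarrow> x \<le> y \<Longrightarrow> log_plus x \<le> log_plus y"
  by (cases "x = 0") (auto simp: log_plus_def max_def)

lemma log_plus_mult:
  assumes "0 \<le> x" "0 \<le> y"
  shows "log_plus (x * y) \<le> log_plus x + log_plus y"
proof (cases "x = 0 \<or> y = 0")
  case True
  then show ?thesis by (auto simp: log_plus_def)
next
  case False
  with assms have "ln (x * y) = ln x + ln y" by (simp add: ln_mult)
  then show ?thesis by (auto simp: log_plus_def)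
qed

lemma log_plus_add:
  assumes "0 \<le> x" "0 \<le> y"
  shows "log_plus (x + y) \<le> log_plus 2 + log_plus x + log_plus y"
proof -
  have "log_plus (x + y) \<le> log_plus (2 * max x y)"
    using assms by (intro log_plus_mono) auto
  also have "\<dots> \<le> log_plus 2 + log_plus (max x y)"
    using assms by (intro log_plus_mult) auto
  also have "log_plus (max x y) \<le> log_plus x + log_plus y"
    by (cases "x \<le> y") (auto simp: max_def)
  finally show ?thesis by simp
qed

lemma log_plus_eq_ln_max: "0 \<le> x \<Longrightarrow> log_plus x = ln (max x 1)"
  by (cases "x = 0") (auto simp: log_plus_def max_def)

lemma log_plus_mean_integrable:
  assumes "f holomorphic_on unit_disc" "r \<in> {0<..<1}" "0 < p"
  shows "(\<lambda>t. log_plus (cmod (f (of_real r * cis t))) powr p / (2 * pi)) integrable_on {0..2*pi}"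
proof (rule integrable_continuous_real)
  have "continuous_on {0..2*pi} (\<lambda>t. f (of_real r * cis t))"
    by (rule continuous_on_compose2[OF holomorphic_on_imp_continuous_on[OF assms(1)]])
       (use assms(2) in \<open>auto intro!: continuous_intros simp: norm_mult\<close>)
  then show "continuous_on {0..2*pi}
      (\<lambda>t. log_plus (cmod (f (of_real r * cis t))) powr p / (2 * pi))"
    using assms(3) unfolding log_plus_eq_ln_max[OF norm_ge_zero]
    by (intro continuous_intros continuous_on_powr') (auto simp: max_def)
qed

lemma powr_add3_le:
  fixes a b c p :: real
  assumes "0 \<le> a" "0 \<le> b" "0 \<le> c" "0 < p"
  shows "(a + b + c) powr p \<le> 3 powr p * (a powr p + b powr p + c powr p)"
proof -
  define m where "m = max a (max b c)"
  have "(a + b + c) powr p \<le> (3 * m) powr p"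
    using assms by (intro powr_mono2) (auto simp: m_def)
  also have "\<dots> = 3 powr p * m powr p"
    using assms by (simp add: powr_mult m_def)
  also have "m powr p \<le> a powr p + b powr p + c powr p"
    by (auto simp: m_def max_def)
  finally show ?thesis by simp
qed

lemma Np_carrierI:
  assumes f: "f \<in> Np_carrier p" and g: "g \<in> Np_carrier p" and p: "0 < p"
    and h: "h \<in> extensional unit_disc" "h holomorphic_on unit_disc"
    and A: "0 \<le> A"
    and le: "\<And>z. z \<in> unit_disc \<Longrightarrow>
      log_plus (cmod (h z)) \<le> A + log_plus (cmod (f z)) + log_plus (cmod (g z))"
  shows "h \<in> Np_carrier p"
proof -
  from f obtain Mf where Mf: "\<And>r. r \<in> {0<..<1} \<Longrightarrow> log_plus_mean p f r \<le> Mf"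
    unfolding Np_carrier_def bdd_above_def by blast
  from g obtain Mg where Mg: "\<And>r. r \<in> {0<..<1} \<Longrightarrow> log_plus_mean p g r \<le> Mg"
    unfolding Np_carrier_def bdd_above_def by blast
  have fg: "f holomorphic_on unit_disc" "g holomorphic_on unit_disc"
    using f g by (auto simp: Np_carrier_def)
  have "log_plus_mean p h r \<le> 3 powr p * (A powr p + Mf + Mg)" if r: "r \<in> {0<..<1}" for r
  proof -
    let ?F = "\<lambda>f t. log_plus (cmod (f (of_real r * cis t))) powr p / (2 * pi)"
    note int = log_plus_mean_integrable[OF _ r p]
    have "log_plus_mean p h r \<le>
        integral {0..2*pi} (\<lambda>t. 3 powr p * (A powr p / (2 * pi) + ?F f t + ?F g t))"
      unfolding log_plus_mean_def
    proof (rule integral_le)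
      show "?F h integrable_on {0..2*pi}" by (rule int[OF h(2)])
      show "(\<lambda>t. 3 powr p * (A powr p / (2 * pi) + ?F f t + ?F g t)) integrable_on {0..2*pi}"
        by (intro integrable_on_mult_right integrable_add int fg integrable_const_ivl)
      fix t
      have z: "of_real r * cis t \<in> unit_disc" using r by (simp add: norm_mult)
      have "log_plus (cmod (h (of_real r * cis t))) powr p
          \<le> (A + log_plus (cmod (f (of_real r * cis t)))
              + log_plus (cmod (g (of_real r * cis t)))) powr p"
        using p by (intro powr_mono2 le z) auto
      also have "\<dots> \<le> 3 powr p * (A powr p + log_plus (cmod (f (of_real r * cis t))) powr p
              + log_plus (cmod (g (of_real r * cis t))) powr p)"
        using A p by (intro powr_add3_le) auto
      finally have "?F h t \<le> \<dots> / (2 * pi)"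
        by (intro divide_right_mono) auto
      then show "?F h t \<le> 3 powr p * (A powr p / (2 * pi) + ?F f t + ?F g t)"
        by (simp only: times_divide_eq_right [symmetric] add_divide_distrib)
    qed
    also have "\<dots> = 3 powr p * (A powr p + log_plus_mean p f r + log_plus_mean p g r)"
      using int[OF fg(1)] int[OF fg(2)]
      by (simp add: integral_add integrable_add integrable_const_ivl log_plus_mean_def)
    also have "\<dots> \<le> 3 powr p * (A powr p + Mf + Mg)"
      using Mf[OF r] Mg[OF r] by (intro mult_left_mono) auto
    finally show ?thesis .
  qed
  then show ?thesis using h unfolding Np_carrier_def bdd_above_def by blast
qed

lemma holomorphic_on_restrict:
  "f holomorphic_on A \<Longrightarrow> (\<lambda>z\<in>A. f z) holomorphic_on A"
  by (rule holomorphic_transform) simp_all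

lemma Hinf_subset_Np_carrier:
  assumes "0 < p"
  shows "Hinf \<subseteq> Np_carrier p"
proof
  fix f assume f: "f \<in> Hinf"
  then obtain M where M: "\<And>z. z \<in> unit_disc \<Longrightarrow> cmod (f z) \<le> M"
    unfolding Hinf_def bounded_iff by blast
  have zero: "(\<lambda>z\<in>unit_disc. 0) \<in> Np_carrier p"
  proof -
    have "log_plus_mean p (\<lambda>z\<in>unit_disc. 0) r = 0" if "r \<in> {0<..<1}" for r
      using that by (simp add: log_plus_mean_def norm_mult log_plus_def)
    then show ?thesis by (auto simp: Np_carrier_def bdd_above_def intro!: holomorphic_on_restrict)
  qed
  show "f \<in> Np_carrier p"
  proof (rule Np_carrierI[OF zero zero assms])
    show "f \<in> extensional unit_disc" "f holomorphic_on unit_disc" using f by (auto simp: Hinf_def)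
    show "0 \<le> log_plus M" by simp
    fix z :: complex assume "z \<in> unit_disc"
    then show "log_plus (cmod (f z)) \<le> log_plus M
        + log_plus (cmod ((\<lambda>z\<in>unit_disc. 0) z)) + log_plus (cmod ((\<lambda>z\<in>unit_disc. 0) z))"
      using log_plus_mono[OF norm_ge_zero M] by (simp add: log_plus_def)
  qed
qed

lemma cring_Np:
  assumes p: "0 < p"
  shows "cring (Np p)"
proof -
  have const: "(\<lambda>z\<in>unit_disc. c) \<in> Np_carrier p" for c
    using Hinf_subset_Np_carrier[OF p] by (rule subsetD) (auto simp: Hinf_def bounded_iff intro!: holomorphic_on_restrict)
  have add: "(\<lambda>z\<in>unit_disc. f z + g z) \<in> Np_carrier p"
    if "f \<in> Np_carrier p" "g \<in> Np_carrier p" for f g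
  proof (rule Np_carrierI[OF that p])
    show "(\<lambda>z\<in>unit_disc. f z + g z) holomorphic_on unit_disc"
      using that by (intro holomorphic_on_restrict holomorphic_intros) (auto simp: Np_carrier_def)
    show "0 \<le> log_plus 2" by simp
    fix z assume "z \<in> unit_disc"
    then have "log_plus (cmod ((\<lambda>z\<in>unit_disc. f z + g z) z)) \<le> log_plus (cmod (f z) + cmod (g z))"
      by (auto intro!: log_plus_mono norm_triangle_ineq)
    also have "\<dots> \<le> log_plus 2 + log_plus (cmod (f z)) + log_plus (cmod (g z))"
      by (rule log_plus_add) auto
    finally show "log_plus (cmod ((\<lambda>z\<in>unit_disc. f z + g z) z)) \<le> \<dots>" .
  qed auto
  have mult: "(\<lambda>z\<in>unit_disc. f z * g z) \<in> Np_carrier p"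
    if "f \<in> Np_carrier p" "g \<in> Np_carrier p" for f g
  proof (rule Np_carrierI[OF that p, where A = 0])
    show "(\<lambda>z\<in>unit_disc. f z * g z) holomorphic_on unit_disc"
      using that by (intro holomorphic_on_restrict holomorphic_intros) (auto simp: Np_carrier_def)
  qed (auto simp: norm_mult log_plus_mult)
  have ext: "f z = undefined" if "f \<in> Np_carrier p" "z \<notin> unit_disc" for f z
    using that by (auto simp: Np_carrier_def extensional_def)
  note closed = add mult const
  note closed' = closed [unfolded restrict_def mem_ball dist_0_norm]
  show ?thesis
  proof (rule cringI)
    show "abelian_group (Np p)"
    proof (rule abelian_groupI)
      fix f assume f: "f \<in> carrier (Np p)"
      have "(\<lambda>z\<in>unit_disc. (\<lambda>z\<in>unit_disc. -1) z * f z) \<in> Np_carrier p"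
        using mult[OF const[of "-1"]] f by (simp add: Np_def)
      moreover have "(\<lambda>z\<in>unit_disc. (\<lambda>z\<in>unit_disc. (\<lambda>z\<in>unit_disc. -1) z * f z) z + f z)
          = (\<lambda>z\<in>unit_disc. 0)"
        by auto
      ultimately show "\<exists>g\<in>carrier (Np p). g \<oplus>\<^bsub>Np p\<^esub> f = \<zero>\<^bsub>Np p\<^esub>"
        by (auto simp only: Np_def partial_object.simps monoid.simps ring.simps intro: bexI)
    qed (auto simp: Np_def closed' ext fun_eq_iff restrict_def)
    show "comm_monoid (Np p)"
      by (rule comm_monoidI) (auto simp: Np_def closed' ext fun_eq_iff restrict_def)
  qed (auto simp: Np_def fun_eq_iff restrict_def ring_distribs)
qed

end

theory Submission
  imports Defs
begin

text \<open>
  Write \<open>S k\<close> for the sum of the \<open>\<bar>\<phi> i (z k)\<bar>\<close> and \<open>a k = \<bar>ln (S k)\<bar>\<close>. The ideal contains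
  the constant \<open>1\<close> as soon as there are \<open>c i\<close> in \<open>N\<^sup>p\<close> for which \<open>1 - (\<Sum>i. \<phi> i * c i)\<close> is a multiple
  of \<open>B\<close> in \<open>N\<^sup>p\<close>. To vanish at \<open>z k\<close> it suffices that \<open>c i (z k) = 1 / \<phi> i (z k)\<close> for one index \<open>i\<close>
  with \<open>\<bar>\<phi> i (z k)\<bar> \<ge> S k / n\<close> and \<open>c i (z k) = 0\<close> for the others; these values have size at
  most \<open>n * exp (a k)\<close>. So the \<open>c i\<close> solve an interpolation problem whose data are controlled by the
  \<open>exp (a k)\<close>, where \<open>\<Sum>k. (1 - \<bar>z k\<bar>\<^sup>2) * a k powr p < \<infinity>\<close>.

  The unbounded part of this problem is carried by one function \<open>exp G\<close>, where \<open>G\<close> is holomorphic,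
  \<open>Re G \<ge> 0\<close>, \<open>Re (G (z k)) \<ge> a k - 1\<close>, and the \<open>p\<close>-th power means of \<open>Re G\<close> on circles are bounded
  (lemma \<open>positive_majorant\<close>). Then \<open>exp G\<close> lies in \<open>N\<^sup>p\<close> and \<open>exp (- G)\<close> is bounded. With
  \<open>c i = exp G * b i\<close>, the values required of \<open>b i\<close> at the points \<open>z k\<close> are bounded, so \<open>b i\<close> can be
  taken bounded because the sequence is interpolating. Moreover the function to be divided by \<open>B\<close> is
  \<open>exp G\<close> times \<open>exp (- G) - (\<Sum>i. \<phi> i * b i)\<close>, and the second factor is bounded. The division
  therefore happens in \<open>H\<^sup>\<infinity>\<close>, where it is the Schwarz lemma (lemma \<open>divide_blaschke_product\<close>). The
  inequality \<open>Re G \<ge> 0\<close> is what reduces division in \<open>N\<^sup>p\<close> to division in \<open>H\<^sup>\<infinity>\<close>.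

  The function \<open>G\<close> is built as follows. A Baire category argument bounds the norms of the interpolating
  functions uniformly, and averaging over roots of unity turns this bound into P. Beurling's functions
  \<open>f k\<close> with \<open>f k (z l) = \<delta>\<^bsub>kl\<^esub>\<close> and \<open>\<Sum>k. \<bar>f k\<bar> \<le> M\<close> (lemma \<open>beurling_functions\<close>). The sum
  \<open>g = (\<Sum>k. a k * f k * peak (z k))\<close>, where the factor \<open>peak (z k)\<close> equals \<open>1\<close> at \<open>z k\<close> and has \<open>p\<close>-th
  power mean at most of order \<open>1 - \<bar>z k\<bar>\<^sup>2\<close>, takes the value \<open>a k\<close> at \<open>z k\<close>, and Jensen's inequality bounds the
  \<open>p\<close>-th power mean of its termwise absolute majorant \<open>\<Phi>\<close>. The Herglotz integral of \<open>\<Phi>\<close> has real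
  part the Poisson integral of \<open>\<Phi>\<close>, which dominates \<open>\<bar>g\<bar>\<close> and keeps the bound on the means. These steps
  are carried out for finitely many points, and a normal family argument passes to all of them.
\<close>

section \<open>Normal families on the disc\<close>

text \<open>
  Montel's theorem applies because a compact subset of the disc lies in a smaller closed disc about
  the origin.
\<close>

lemma montel_disc:
  fixes f :: "nat \<Rightarrow> complex \<Rightarrow> complex" and C :: "real \<Rightarrow> real"
  assumes hol: "\<And>n. f n holomorphic_on unit_disc"
    and bd: "\<And>n r w. \<lbrakk>0 < r; r < 1; cmod w \<le> r\<rbrakk> \<Longrightarrow> cmod (f n w) \<le> C r"
  obtains g \<sigma> where "g holomorphic_on unit_disc" "strict_mono (\<sigma> :: nat \<Rightarrow> nat)"
    "\<And>w. w \<in> unit_disc \<Longrightarrow> (\<lambda>n. f (\<sigma> n) w) \<longlonglongrightarrow> g w"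
proof -
  have "\<exists>M. \<forall>h\<in>range f. \<forall>w\<in>S. cmod (h w) \<le> M" if S: "compact S" "S \<subseteq> unit_disc" for S
  proof (cases "S = {}")
    case False
    have "continuous_on S (\<lambda>w. cmod w)" by (intro continuous_intros)
    from continuous_attains_sup[OF S(1) False this] obtain s
      where s: "s \<in> S" "\<And>w. w \<in> S \<Longrightarrow> cmod w \<le> cmod s" by blast
    have s1: "cmod s < 1" using s S by auto
    have "cmod (f n w) \<le> C ((1 + cmod s) / 2)" if "w \<in> S" for n w
      using bd[of "(1 + cmod s) / 2" w n] s(2)[OF that] s1 norm_ge_zero[of s]
      by (auto simp: field_simps)
    then show ?thesis by blast
  qed auto
  note bdS = this
  show ?thesis
  proof (rule Montel[of unit_disc "range f" f, OF open_ball])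
    show "h holomorphic_on unit_disc" if "h \<in> range f" for h using that hol by auto
    show "\<exists>B. \<forall>h\<in>range f. \<forall>w\<in>S. cmod (h w) \<le> B" if "compact S" "S \<subseteq> unit_disc" for S
      using that by (rule bdS)
    fix g \<sigma> assume "g holomorphic_on unit_disc" "strict_mono (\<sigma> :: nat \<Rightarrow> nat)"
      "\<And>w. w \<in> unit_disc \<Longrightarrow> (\<lambda>n. f (\<sigma> n) w) \<longlonglongrightarrow> g w"
    then show ?thesis by (rule that)
  qed simp
qed

lemma montel_disc_bounded:
  fixes f :: "nat \<Rightarrow> complex \<Rightarrow> complex"
  assumes hol: "\<And>n. f n holomorphic_on unit_disc"
    and bd: "\<And>n w. w \<in> unit_disc \<Longrightarrow> cmod (f n w) \<le> M"
  obtains g \<sigma> where "g holomorphic_on unit_disc" "\<And>w. w \<in> unit_disc \<Longrightarrow> cmod (g w) \<le> M"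
    "strict_mono (\<sigma> :: nat \<Rightarrow> nat)" "\<And>w. w \<in> unit_disc \<Longrightarrow> (\<lambda>n. f (\<sigma> n) w) \<longlonglongrightarrow> g w"
proof -
  have bd': "cmod (f n w) \<le> M" if "0 < r" "r < 1" "cmod w \<le> r" for n r w
    using that by (intro bd) auto
  obtain g \<sigma> where g: "g holomorphic_on unit_disc" "strict_mono (\<sigma> :: nat \<Rightarrow> nat)"
    "\<And>w. w \<in> unit_disc \<Longrightarrow> (\<lambda>n. f (\<sigma> n) w) \<longlonglongrightarrow> g w"
  proof (rule montel_disc[of f "\<lambda>_. M"])
    show "f n holomorphic_on unit_disc" for n by (rule hol)
    show "cmod (f n w) \<le> M" if "0 < r" "r < 1" "cmod w \<le> r" for n r w using that by (rule bd')
  qed (rule that)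
  have gM: "cmod (g w) \<le> M" if w: "w \<in> unit_disc" for w
    by (rule Lim_norm_ubound[OF sequentially_bot g(3)[OF w]]) (use bd[OF w] in auto)
  show ?thesis
  proof (rule that)
    show "cmod (g w) \<le> M" if "w \<in> unit_disc" for w using that by (rule gM)
    show "(\<lambda>n. f (\<sigma> n) w) \<longlonglongrightarrow> g w" if "w \<in> unit_disc" for w using that by (rule g)
  qed (rule g)+
qed

section \<open>Interpolation with uniform bounds\<close>

lemma interpolating_sequence_in_disc:
  "interpolating_sequence K z \<Longrightarrow> z ` K \<subseteq> unit_disc"
  unfolding interpolating_sequence_def by (rule conjunct1)

text \<open>
  The bound \<open>M\<close> is explicit because the sets of data that can be interpolated with norm at most \<open>M\<close>
  are the closed sets to which Baire's theorem is applied.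
\<close>

definition interpolable :: "nat set \<Rightarrow> (nat \<Rightarrow> complex) \<Rightarrow> real \<Rightarrow> (nat \<Rightarrow> complex) \<Rightarrow> bool"
  where "interpolable K z M \<omega> \<longleftrightarrow> (\<exists>f. f holomorphic_on unit_disc \<and>
    (\<forall>w\<in>unit_disc. cmod (f w) \<le> M) \<and> (\<forall>k\<in>K. f (z k) = \<omega> k))"

lemma interpolable_closed:
  assumes z: "z ` K \<subseteq> unit_disc" and int: "\<And>n. interpolable K z M (\<omega> n)"
    and lim: "\<And>k. k \<in> K \<Longrightarrow> (\<lambda>n. \<omega> n k) \<longlonglongrightarrow> \<eta> k"
  shows "interpolable K z M \<eta>"
proof -
  obtain f where f: "\<And>n. f n holomorphic_on unit_disc"
    "\<And>n w. w \<in> unit_disc \<Longrightarrow> cmod (f n w) \<le> M" "\<And>n k. k \<in> K \<Longrightarrow> f n (z k) = \<omega> n k"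
    using int unfolding interpolable_def by metis
  obtain g \<sigma> where g: "g holomorphic_on unit_disc" "\<And>w. w \<in> unit_disc \<Longrightarrow> cmod (g w) \<le> M"
    "strict_mono (\<sigma> :: nat \<Rightarrow> nat)" "\<And>w. w \<in> unit_disc \<Longrightarrow> (\<lambda>n. f (\<sigma> n) w) \<longlonglongrightarrow> g w"
  proof (rule montel_disc_bounded[of f M])
    show "f n holomorphic_on unit_disc" for n by (rule f)
    show "cmod (f n w) \<le> M" if "w \<in> unit_disc" for n w using that by (rule f)
  qed (rule that)
  have "g (z k) = \<eta> k" if k: "k \<in> K" for k
  proof (rule LIMSEQ_unique)
    show "(\<lambda>n. f (\<sigma> n) (z k)) \<longlonglongrightarrow> g (z k)" using z k by (intro g) auto
    show "(\<lambda>n. f (\<sigma> n) (z k)) \<longlonglongrightarrow> \<eta> k"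
      using LIMSEQ_subseq_LIMSEQ[OF lim[OF k] g(3)] f(3)[OF k] by (simp add: o_def)
  qed
  then show ?thesis unfolding interpolable_def using g(1,2) by (intro exI[of _ g]) simp
qed

lemma interpolable_diff_scale:
  assumes "interpolable K z M \<omega>" "interpolable K z M \<eta>"
  shows "interpolable K z (2 * M * cmod c) (\<lambda>k. c * (\<omega> k - \<eta> k))"
proof -
  obtain f g where f: "f holomorphic_on unit_disc" "\<And>w. w \<in> unit_disc \<Longrightarrow> cmod (f w) \<le> M" "\<And>k. k \<in> K \<Longrightarrow> f (z k) = \<omega> k"
    and g: "g holomorphic_on unit_disc" "\<And>w. w \<in> unit_disc \<Longrightarrow> cmod (g w) \<le> M" "\<And>k. k \<in> K \<Longrightarrow> g (z k) = \<eta> k"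
    using assms unfolding interpolable_def by metis
  have "cmod (c * (f w - g w)) \<le> 2 * M * cmod c" if w: "w \<in> unit_disc" for w
  proof -
    have "cmod (f w - g w) \<le> M + M" using norm_triangle_ineq4[of "f w" "g w"] f(2)[OF w] g(2)[OF w] by linarith
    then have "cmod c * cmod (f w - g w) \<le> cmod c * (M + M)" by (rule mult_left_mono) simp
    then show ?thesis by (simp add: norm_mult mult.commute mult.left_commute)
  qed
  moreover have "(\<lambda>w. c * (f w - g w)) holomorphic_on unit_disc" using f g by (intro holomorphic_intros)
  ultimately show ?thesis unfolding interpolable_def using f(3) g(3) by (intro exI[of _ "\<lambda>w. c * (f w - g w)"]) auto
qed

text \<open>
  A Cauchy sequence for the supremum norm is uniformly Cauchy, and its uniform limit is again bounded.
\<close>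

lemma complete_bounded_sequences: "complete (UNIV :: (nat \<Rightarrow>\<^sub>C complex) set)"
proof (rule completeI)
  fix s :: "nat \<Rightarrow> nat \<Rightarrow>\<^sub>C complex"
  assume "Cauchy s"
  then have "uniformly_Cauchy_on UNIV (\<lambda>n. apply_bcontfun (s n))"
    unfolding Cauchy_def uniformly_Cauchy_on_def by (meson dist_bounded le_less_trans)
  then obtain g where "uniform_limit UNIV (\<lambda>n. apply_bcontfun (s n)) g sequentially"
    using Cauchy_uniformly_convergent uniformly_convergent_on_def by blast
  from uniform_limit_bcontfunE[OF this sequentially_bot]
  obtain l where "s \<longlonglongrightarrow> l" by metis
  then show "\<exists>l\<in>UNIV. s \<longlonglongrightarrow> l" by blast
qed

text \<open>
  The open mapping principle for the restriction map from \<open>H\<^sup>\<infinity>\<close> to bounded sequences. The sequences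
  that can be interpolated with norm at most \<open>m\<close> form a closed set by Montel's theorem, and these sets
  cover the Banach space of all bounded sequences. Hence one of them contains a ball, and differences of
  elements of that ball, rescaled, exhaust the unit ball.
\<close>

lemma uniform_interpolation_constant:
  assumes "interpolating_sequence K z"
  obtains M where "M > 0" "\<And>\<omega>. (\<And>k. cmod (\<omega> k) \<le> 1) \<Longrightarrow> interpolable K z M \<omega>"
proof -
  define E where "E m = {\<omega> :: nat \<Rightarrow>\<^sub>C complex. interpolable K z (real m) \<omega>}" for m
  note zK = interpolating_sequence_in_disc[OF assms]
  have closed: "closed (E m)" for m
    unfolding closed_sequential_limits
  proof (intro allI impI)
    fix x l assume *: "(\<forall>n. x n \<in> E m) \<and> x \<longlonglongrightarrow> l"
    have "uniform_limit UNIV (\<lambda>n. apply_bcontfun (x n)) (apply_bcontfun l) sequentially"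
      using * by (intro tendsto_bcontfun_uniform_limit) simp
    then have lim: "(\<lambda>n. apply_bcontfun (x n) k) \<longlonglongrightarrow> apply_bcontfun l k" for k
      by (rule tendsto_uniform_limitI) simp
    have "interpolable K z (real m) (apply_bcontfun l)"
      by (rule interpolable_closed[OF zK _ lim]) (use * in \<open>simp add: E_def\<close>)
    then show "l \<in> E m" by (simp add: E_def)
  qed
  have cover: "\<omega> \<in> \<Union>(range E)" for \<omega> :: "nat \<Rightarrow>\<^sub>C complex"
  proof -
    have "bounded (apply_bcontfun \<omega> ` K)" using bounded_subset[OF bounded_apply_bcontfun] by blast
    then obtain f where f: "f \<in> Hinf" "\<forall>k\<in>K. f (z k) = \<omega> k"
      using assms unfolding interpolating_sequence_def by metis
    then obtain B where B: "\<And>w. w \<in> unit_disc \<Longrightarrow> cmod (f w) \<le> B" unfolding Hinf_def bounded_iff by blast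
    obtain m where "B \<le> real m" using real_arch_simple by blast
    then have "cmod (f w) \<le> real m" if "w \<in> unit_disc" for w using B[OF that] by simp
    then have "\<omega> \<in> E m" unfolding E_def interpolable_def using f
      by (auto simp: Hinf_def intro!: exI[of _ f])
    then show "\<omega> \<in> \<Union>(range E)" by blast
  qed
  have "\<exists>m. interior (E m) \<noteq> {}"
  proof (rule ccontr)
    assume *: "\<not> ?thesis"
    have "Met_TC.mcomplete TYPE(nat \<Rightarrow>\<^sub>C complex)"
      by (simp add: complete_bounded_sequences)
    from Met_TC.metric_Baire_category_alt[OF this, of "range E"] * closed
    have "interior (\<Union>(range E)) = {}" by auto
    moreover have "\<Union>(range E) = UNIV" using cover by blast
    ultimately show False by simp
  qed
  then obtain m \<omega>0 \<epsilon> where b: "\<epsilon> > 0" "ball \<omega>0 \<epsilon> \<subseteq> E m"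
    by (metis ex_in_conv mem_interior)
  define M where "M = 2 * real m * (2 / \<epsilon>) + 1"
  show ?thesis
  proof (rule that[of M])
    show "M > 0" using b by (simp add: M_def add_nonneg_pos)
    fix \<omega> :: "nat \<Rightarrow> complex" assume \<omega>: "\<And>k. cmod (\<omega> k) \<le> 1"
    have bc: "\<omega> \<in> bcontfun" by (rule bcontfun_normI[OF _ \<omega>]) simp
    define v where "v = Bcontfun \<omega>"
    have v: "apply_bcontfun v = \<omega>" unfolding v_def using bc by (simp add: Bcontfun_inverse)
    have "norm v \<le> 1" by (rule norm_bound) (simp add: v \<omega>)
    then have "\<omega>0 + (\<epsilon>/2) *\<^sub>R v \<in> ball \<omega>0 \<epsilon>" using b(1) mult_left_mono[of "norm v" 1 "\<epsilon>/2"] by (simp add: dist_norm)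
    moreover have "\<omega>0 \<in> ball \<omega>0 \<epsilon>" using b(1) by simp
    ultimately have "\<omega>0 + (\<epsilon>/2) *\<^sub>R v \<in> E m" "\<omega>0 \<in> E m" using b(2) by blast+
    then have "interpolable K z (real m) (\<omega>0 + (\<epsilon>/2) *\<^sub>R v)" "interpolable K z (real m) \<omega>0"
      unfolding E_def by simp_all
    from interpolable_diff_scale[OF this, of "of_real (2/\<epsilon>)"] b(1)
    have "interpolable K z (2 * real m * (2/\<epsilon>)) \<omega>" by (simp add: v scaleR_conv_of_real norm_divide)
    then show "interpolable K z M \<omega>" unfolding interpolable_def M_def by fastforce
  qed
qed

section \<open>Beurling's functions\<close>

text \<open>Orthogonality of the characters of the cyclic group of order \<open>N\<close>.\<close>

lemma sum_roots_of_unity_pairing: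
  assumes "j < N" "l < N"
  shows "(\<Sum>k<N. cis (2 * pi * real k * (real j - real l) / real N)) = (if j = l then of_nat N else 0)"
proof (cases "j = l")
  case False
  define x where "x = cis (2 * pi * (real j - real l) / real N)"
  have N: "N > 0" using assms by auto
  have pw: "cis (2 * pi * real k * (real j - real l) / real N) = x ^ k" for k
    unfolding x_def Complex.DeMoivre by (rule arg_cong[of _ _ cis]) simp
  have xN: "x ^ N = 1"
  proof -
    have "x ^ N = cis (2 * pi * of_int (int j - int l))" unfolding x_def Complex.DeMoivre using N
      by (intro arg_cong[of _ _ cis]) simp
    also have "\<dots> = 1" by (rule cis_multiple_2pi) auto
    finally show ?thesis .
  qed
  have "x \<noteq> 1"
  proof
    assume "x = 1"
    then have "cos (2 * pi * (real j - real l) / real N) = 1" by (simp add: x_def complex_eq_iff)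
    then obtain m :: int where "2 * pi * (real j - real l) / real N = of_int m * 2 * pi"
      unfolding cos_one_2pi_int by blast
    then have "2 * pi * (real j - real l) = 2 * pi * (of_int m * real N)" using N by (simp add: field_simps)
    then have "real j - real l = of_int m * real N" by (subst (asm) mult_left_cancel) auto
    then have "of_int (int j - int l) = (of_int (m * int N) :: real)" by simp
    then have m: "int j - int l = m * int N" by (rule of_int_eq_iff[THEN iffD1])
    have "\<bar>int j - int l\<bar> < int N" using assms by linarith
    then have "\<bar>m\<bar> * int N < 1 * int N" using m by (simp add: abs_mult)
    then have "m = 0" using N by (simp only: mult_less_cancel_right) auto
    then show False using m False by simp
  qed
  then have "(\<Sum>k<N. x ^ k) = 0" using xN by (simp add: geometric_sum)
  then show ?thesis using False by (simp add: pw)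
qed simp

text \<open>Parseval's identity for the discrete Fourier transform.\<close>

lemma parseval_roots_of_unity:
  fixes h :: "nat \<Rightarrow> complex"
  shows "(\<Sum>k<N. (cmod (\<Sum>j<N. cis (2 * pi * real k * real j / real N) * h j))\<^sup>2) = real N * (\<Sum>j<N. (cmod (h j))\<^sup>2)"
proof -
  define e where "e k j = cis (2 * pi * real k * real j / real N)" for k j
  have ee: "e k j * cnj (e k l) = cis (2 * pi * real k * (real j - real l) / real N)" for k j l
    unfolding e_def cis_cnj cis_mult by (rule arg_cong[of _ _ cis]) (simp add: diff_divide_distrib algebra_simps)
  have "complex_of_real (\<Sum>k<N. (cmod (\<Sum>j<N. e k j * h j))\<^sup>2)
      = (\<Sum>k<N. (\<Sum>j<N. e k j * h j) * cnj (\<Sum>l<N. e k l * h l))"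
    by (simp only: of_real_sum complex_norm_square)
  also have "\<dots> = (\<Sum>k<N. \<Sum>j<N. \<Sum>l<N. (e k j * cnj (e k l)) * (h j * cnj (h l)))"
    by (simp add: sum_product mult_ac)
  also have "\<dots> = (\<Sum>j<N. \<Sum>k<N. \<Sum>l<N. (e k j * cnj (e k l)) * (h j * cnj (h l)))"
    by (rule sum.swap)
  also have "\<dots> = (\<Sum>j<N. \<Sum>l<N. \<Sum>k<N. (e k j * cnj (e k l)) * (h j * cnj (h l)))"
    by (intro sum.cong refl sum.swap)
  also have "\<dots> = (\<Sum>j<N. \<Sum>l<N. (if j = l then of_nat N else 0) * (h j * cnj (h l)))"
    unfolding sum_distrib_right[symmetric] ee
    by (intro sum.cong refl arg_cong2[of _ _ _ _ "(*)"] sum_roots_of_unity_pairing) auto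
  also have "\<dots> = (\<Sum>j<N. of_nat N * (h j * cnj (h j)))"
    by (intro sum.cong refl) (simp add: if_distrib[of "\<lambda>x. x * _"] sum.delta' cong: if_cong)
  also have "\<dots> = complex_of_real (real N * (\<Sum>j<N. (cmod (h j))\<^sup>2))"
    by (simp only: complex_norm_square sum_distrib_left of_real_mult of_real_sum of_real_of_nat_eq)
  finally show ?thesis unfolding of_real_eq_iff e_def .
qed

text \<open>
  Let \<open>h j\<close> interpolate the values \<open>exp (- 2 \<pi> i j k / N)\<close> at the points \<open>z k\<close> with norm at most \<open>M\<close>.
  The discrete Fourier transform \<open>g k\<close> of the \<open>h j\<close>, divided by \<open>N\<close>, takes the value \<open>\<delta>\<^bsub>kl\<^esub>\<close> at
  \<open>z l\<close>, and Parseval's identity gives \<open>\<Sum>k. \<bar>g k\<bar>\<^sup>2 \<le> M\<^sup>2\<close> at every point. Passing to \<open>f k = (g k)\<^sup>2\<close>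
  keeps the values \<open>0\<close> and \<open>1\<close> and turns the quadratic bound into an \<open>\<ell>\<^sup>1\<close> bound independent of \<open>N\<close>.
\<close>

lemma beurling_functions:
  assumes z: "interpolating_sequence K z"
  obtains M where "M > 0" "\<And>N. \<exists>f :: nat \<Rightarrow> complex \<Rightarrow> complex.
    (\<forall>k. f k holomorphic_on unit_disc) \<and>
    (\<forall>k<N. \<forall>l\<in>K. l < N \<longrightarrow> f k (z l) = (if k = l then 1 else 0)) \<and>
    (\<forall>w\<in>unit_disc. (\<Sum>k<N. cmod (f k w)) \<le> M)"
proof -
  obtain M where M: "M > 0" "\<And>\<omega>. (\<And>k. cmod (\<omega> k) \<le> 1) \<Longrightarrow> interpolable K z M \<omega>"
    using uniform_interpolation_constant[OF z] by metis
  have "\<exists>f :: nat \<Rightarrow> complex \<Rightarrow> complex.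
    (\<forall>k. f k holomorphic_on unit_disc) \<and>
    (\<forall>k<N. \<forall>l\<in>K. l < N \<longrightarrow> f k (z l) = (if k = l then 1 else 0)) \<and>
    (\<forall>w\<in>unit_disc. (\<Sum>k<N. cmod (f k w)) \<le> M\<^sup>2)" for N
  proof (cases "N = 0")
    case True
    then show ?thesis by (intro exI[of _ "\<lambda>_ _. 0"]) auto
  next
    case False
    have "\<exists>h. h holomorphic_on unit_disc \<and> (\<forall>w\<in>unit_disc. cmod (h w) \<le> M) \<and>
        (\<forall>k\<in>K. h (z k) = cis (- (2 * pi * real k * real j / real N)))" for j
      using M(2)[of "\<lambda>k. cis (- (2 * pi * real k * real j / real N))"] unfolding interpolable_def by simp
    then obtain h where h: "\<And>j. h j holomorphic_on unit_disc" "\<And>j w. w \<in> unit_disc \<Longrightarrow> cmod (h j w) \<le> M"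
      "\<And>j k. k \<in> K \<Longrightarrow> h j (z k) = cis (- (2 * pi * real k * real j / real N))" by metis
    define g where "g k w = (\<Sum>j<N. cis (2 * pi * real k * real j / real N) * h j w) / of_nat N" for k w
    define f where "f k w = (g k w)\<^sup>2" for k w
    have "g k (z l) = (if k = l then 1 else 0)" if "k < N" "l \<in> K" "l < N" for k l
    proof -
      have "g k (z l) = (\<Sum>j<N. cis (2 * pi * real j * (real k - real l) / real N)) / of_nat N"
        unfolding g_def h(3)[OF that(2)] cis_mult
        by (intro arg_cong2[of _ _ _ _ "(/)"] sum.cong refl arg_cong[of _ _ cis])
          (simp add: diff_divide_distrib algebra_simps)
      then show ?thesis using sum_roots_of_unity_pairing[OF that(1,3)] False by simp
    qed
    moreover have "g k holomorphic_on unit_disc" for k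
      unfolding g_def[abs_def] by (intro holomorphic_intros h) (use False in auto)
    moreover have "(\<Sum>k<N. cmod (f k w)) \<le> M\<^sup>2" if w: "w \<in> unit_disc" for w
    proof -
      have "(\<Sum>k<N. cmod (f k w)) = (\<Sum>k<N. (cmod (\<Sum>j<N. cis (2 * pi * real k * real j / real N) * h j w))\<^sup>2) / (real N)\<^sup>2"
        unfolding f_def g_def norm_power norm_divide power_divide norm_of_nat
        by (rule sum_divide_distrib[symmetric])
      also have "\<dots> = (\<Sum>j<N. (cmod (h j w))\<^sup>2) / real N"
        unfolding parseval_roots_of_unity using False by (simp add: power2_eq_square)
      also have "\<dots> \<le> (\<Sum>j<N. M\<^sup>2) / real N"
        using h(2)[OF w] by (intro divide_right_mono sum_mono power_mono) auto
      also have "\<dots> = M\<^sup>2" using False by simp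
      finally show ?thesis .
    qed
    ultimately show ?thesis
      by (intro exI[of _ f]) (auto simp: f_def[abs_def] intro!: holomorphic_intros)
  qed
  with M(1) show ?thesis by (intro that[of "M\<^sup>2"]) auto
qed

section \<open>The Poisson and Herglotz kernels\<close>

lemma one_minus_cnj_mult_nonzero:
  assumes "a \<in> unit_disc" "cmod w \<le> 1"
  shows "1 - cnj a * w \<noteq> 0"
proof
  assume "1 - cnj a * w = 0"
  then have "cmod a * cmod w = 1" by (metis complex_mod_cnj eq_iff_diff_eq_0 norm_mult norm_one)
  moreover have "cmod a * cmod w \<le> cmod a * 1" using assms by (intro mult_left_mono) auto
  ultimately show False using assms by simp
qed

definition poisson_kernel :: "complex \<Rightarrow> real \<Rightarrow> real"
  where "poisson_kernel w t = (1 - (cmod w)\<^sup>2) / (cmod (cis t - w))\<^sup>2"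

definition herglotz_kernel :: "complex \<Rightarrow> real \<Rightarrow> complex"
  where "herglotz_kernel w t = (cis t + w) / (cis t - w)"

lemma cis_minus_nonzero: "w \<in> unit_disc \<Longrightarrow> cis t - w \<noteq> 0"
  by (metis eq_iff_diff_eq_0 mem_ball_0 norm_cis less_irrefl)

lemma Re_herglotz_kernel: 
  assumes "w \<in> unit_disc"
  shows "Re (herglotz_kernel w t) = poisson_kernel w t"
proof -
  have "herglotz_kernel w t = (cis t + w) * cnj (cis t - w) / of_real ((cmod (cis t - w))\<^sup>2)"
    unfolding herglotz_kernel_def complex_norm_square using cis_minus_nonzero[OF assms, of t] 
    by (simp add: divide_simps)
  moreover have "Re ((cis t + w) * cnj (cis t - w)) = 1 - (cmod w)\<^sup>2"
    unfolding cmod_power2 using sin_cos_squared_add[of t] by (simp add: algebra_simps power2_eq_square)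
  ultimately show ?thesis unfolding poisson_kernel_def by (metis Re_divide_of_real)
qed

lemma poisson_kernel_nonneg: "w \<in> unit_disc \<Longrightarrow> 0 \<le> poisson_kernel w t"
  unfolding poisson_kernel_def by (auto simp: power_le_one)

text \<open>
  The two denominators are the squared distances of \<open>r\<close> from \<open>cis (t - s)\<close> and from its conjugate.
  By this symmetry the kernel integrates to \<open>2 * pi\<close> in either angle.
\<close>

lemma poisson_kernel_swap: "poisson_kernel (of_real r * cis s) t = poisson_kernel (of_real r * cis t) s"
proof -
  have "cmod (cis t - of_real r * cis s) = cmod (cis s - of_real r * cis t)"
  proof -
    have "cis s * cis t * cnj (cis t - of_real r * cis s) = cis s - of_real r * cis t"
      by (simp add: algebra_simps cis_cnj cis_mult)
    then have "cmod (cis s - of_real r * cis t) = cmod (cis s * cis t * cnj (cis t - of_real r * cis s))" by simp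
    also have "\<dots> = cmod (cis t - of_real r * cis s)" by (simp only: norm_mult norm_cis complex_mod_cnj mult_1)
    finally show ?thesis by simp
  qed
  then show ?thesis by (simp add: poisson_kernel_def norm_mult)
qed

text \<open>
  Cauchy's formula at \<open>w\<close> for \<open>u \<mapsto> f u * (1 - \<bar>w\<bar>\<^sup>2) / (1 - cnj w * u)\<close>. The extra factor is \<open>1\<close> at
  \<open>u = w\<close>, and on the unit circle it turns the Cauchy kernel into the Poisson kernel, because there
  \<open>1 - cnj w * u = u * cnj (u - w)\<close>.
\<close>

lemma poisson_formula:
  fixes f :: "complex \<Rightarrow> complex"
  assumes f: "f holomorphic_on unit_disc" "continuous_on (cball 0 1) f" and w: "w \<in> unit_disc"
  shows "((\<lambda>t. of_real (poisson_kernel w t) * f (cis t)) has_integral (2 * pi * f w)) {0..2*pi}"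
proof -
  define g where "g u = f u * (1 - of_real ((cmod w)\<^sup>2)) / (1 - cnj w * u)" for u
  have nz: "1 - cnj w * u \<noteq> 0" if "u \<in> cball 0 1" for u
    using one_minus_cnj_mult_nonzero[OF w] that by simp
  have g: "g holomorphic_on unit_disc" "continuous_on (cball 0 1) g"
    unfolding g_def using nz by (auto intro!: holomorphic_intros continuous_intros f)
  have "((\<lambda>u. g u / (u - w)) has_contour_integral 2 * of_real pi * \<i> * g w) (part_circlepath 0 1 0 (2*pi))"
    using Cauchy_integral_circlepath[OF g(2,1), of w] w by (simp add: circlepath_def)
  then have "((\<lambda>t. g (cis t) / (cis t - w) * \<i> * cis t) has_integral (2 * of_real pi * \<i> * g w)) {0..2*pi}"
    by (subst (asm) has_contour_integral_part_circlepath_iff) auto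
  then have I: "((\<lambda>t. (-\<i>) * (g (cis t) / (cis t - w) * \<i> * cis t)) has_integral ((-\<i>) * (2 * of_real pi * \<i> * g w))) {0..2*pi}"
    by (rule has_integral_mult_right)
  have I1: "(-\<i>) * (g (cis t) / (cis t - w) * \<i> * cis t) = of_real (poisson_kernel w t) * f (cis t)" for t
  proof -
    have 1: "1 - cnj w * cis t = cis t * cnj (cis t - w)" by (simp add: algebra_simps cis_cnj cis_mult)
    have nzc: "cnj (cis t - w) \<noteq> 0" "cis t - w \<noteq> 0" using cis_minus_nonzero[OF w, of t] by (auto simp del: complex_cnj_diff)
    have "(-\<i>) * (g (cis t) / (cis t - w) * \<i> * cis t) = (-\<i> * \<i>) * (g (cis t) * cis t / (cis t - w))"
      by (simp only: times_divide_eq_right times_divide_eq_left mult_ac)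
    also have "\<dots> = g (cis t) * cis t / (cis t - w)" by simp
    also have "\<dots> = f (cis t) * (1 - of_real ((cmod w)\<^sup>2)) / ((cis t - w) * cnj (cis t - w))"
      unfolding g_def 1 using nzc by (simp add: divide_simps del: complex_cnj_diff)
    finally show ?thesis unfolding poisson_kernel_def by (simp only: complex_norm_square[symmetric]) simp
  qed
  have I2: "(-\<i>) * (2 * of_real pi * \<i> * g w) = 2 * pi * f w"
  proof -
    have "1 - of_real ((cmod w)\<^sup>2) = 1 - cnj w * w" by (simp only: complex_norm_square mult.commute)
    then have "g w = f w" using nz[of w] w unfolding g_def by simp
    then show ?thesis by simp
  qed
  show ?thesis using I unfolding I1 I2 .
qed

lemma poisson_kernel_integral:
  assumes "w \<in> unit_disc"
  shows "(poisson_kernel w has_integral 2 * pi) {0..2*pi}"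
proof -
  have "((\<lambda>t. complex_of_real (poisson_kernel w t)) has_integral of_real (2 * pi)) {0..2*pi}"
    using poisson_formula[of "\<lambda>_. 1" w] assms by simp
  from has_integral_Re[OF this] show ?thesis by simp
qed

lemma continuous_poisson_kernel_right:
  "w \<in> unit_disc \<Longrightarrow> continuous_on A (poisson_kernel w)"
  unfolding poisson_kernel_def
  by (intro continuous_intros) (use cis_minus_nonzero in auto)

section \<open>Jensen's inequality for powers\<close>

text \<open>
  Both Jensen inequalities below follow by averaging the tangent line of \<open>x powr p\<close> at the mean. At
  \<open>x = 0\<close>, an end point of the domain of convexity, the inequality reads \<open>m powr p \<le> p * m powr p\<close>.
\<close>

lemma powr_above_tangent:
  fixes x m p :: real
  assumes "0 \<le> x" "0 < m" "1 \<le> p"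
  shows "m powr p + p * m powr (p - 1) * (x - m) \<le> x powr p"
proof (cases "x = 0")
  case True
  have "m powr p = m powr (p - 1) * m" using powr_add[of m "p - 1" 1] assms(2) by simp
  moreover have "m powr (p - 1) * m \<le> p * (m powr (p - 1) * m)" using assms mult_right_mono[of 1 p "m powr (p - 1) * m"] by simp
  ultimately show ?thesis using True assms by (simp add: algebra_simps)
next
  case False
  have "x powr p - m powr p \<ge> (p * m powr (p - 1)) * (x - m)"
  proof (rule convex_on_imp_above_tangent[OF powr_convex])
    show "connected {0::real<..}" by (rule connected_Ioi)
    show "((\<lambda>x. x powr p) has_field_derivative p * m powr (p - 1)) (at m within {0<..})"
      by (rule has_field_derivative_at_within[OF has_real_derivative_powr[OF assms(2)]])
    show "1 \<le> p" by fact
    show "m \<in> interior {0<..}" using assms(2) interior_open[OF open_greaterThan, of "0::real"] by simp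
    show "x \<in> {0<..}" using False assms(1) by simp
  qed
  then show ?thesis by linarith
qed

text \<open>
  Weights of total mass below \<open>1\<close> are admissible because the missing mass can be placed at \<open>0\<close>, where
  \<open>x powr p\<close> vanishes.
\<close>

lemma powr_sum_le_weighted:
  fixes p :: real
  assumes "finite A" "1 \<le> p" and t: "\<And>k. k \<in> A \<Longrightarrow> 0 \<le> t k" "sum t A \<le> 1" and x: "\<And>k. k \<in> A \<Longrightarrow> 0 \<le> x k"
  shows "(\<Sum>k\<in>A. t k * x k) powr p \<le> (\<Sum>k\<in>A. t k * x k powr p)"
proof -
  define m where "m = (\<Sum>k\<in>A. t k * x k)"
  have m0: "0 \<le> m" unfolding m_def using t x by (intro sum_nonneg) auto
  show ?thesis
  proof (cases "m = 0")
    case True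
    have "0 \<le> (\<Sum>k\<in>A. t k * x k powr p)" using t by (intro sum_nonneg) auto
    then show ?thesis using True unfolding m_def by simp
  next
    case False
    with m0 have m: "m > 0" by simp
    have mp: "m powr (p - 1) * m = m powr p" using powr_add[of m "p - 1" 1] m by simp
    have "0 \<le> (p - 1) * (1 - sum t A) * m powr p" using assms by (intro mult_nonneg_nonneg) auto
    then have "m powr p \<le> sum t A * m powr p + p * m powr (p - 1) * (m - sum t A * m)"
      unfolding mp[symmetric] by (simp add: algebra_simps)
    also have "\<dots> = (\<Sum>k\<in>A. t k * m powr p + p * m powr (p - 1) * (t k * x k - t k * m))"
      unfolding sum.distrib sum_distrib_left[symmetric] sum_subtractf m_def[symmetric]
      by (simp only: sum_distrib_right)
    also have "\<dots> = (\<Sum>k\<in>A. t k * (m powr p + p * m powr (p - 1) * (x k - m)))"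
      by (simp add: algebra_simps)
    also have "\<dots> \<le> (\<Sum>k\<in>A. t k * x k powr p)"
      by (intro sum_mono mult_left_mono powr_above_tangent x m assms)
    finally show ?thesis unfolding m_def .
  qed
qed

lemma powr_integral_le_weighted:
  fixes p :: real and \<kappa> \<Phi> :: "real \<Rightarrow> real"
  assumes p: "1 \<le> p" and \<kappa>: "continuous_on {a..b} \<kappa>" "\<And>t. t \<in> {a..b} \<Longrightarrow> 0 \<le> \<kappa> t" "integral {a..b} \<kappa> = 1"
    and \<Phi>: "continuous_on {a..b} \<Phi>" "\<And>t. t \<in> {a..b} \<Longrightarrow> 0 \<le> \<Phi> t"
  shows "integral {a..b} (\<lambda>t. \<kappa> t * \<Phi> t) powr p \<le> integral {a..b} (\<lambda>t. \<kappa> t * \<Phi> t powr p)"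
proof -
  define m where "m = integral {a..b} (\<lambda>t. \<kappa> t * \<Phi> t)"
  have i1: "\<kappa> integrable_on {a..b}" by (intro integrable_continuous_real \<kappa>)
  have i2: "(\<lambda>t. \<kappa> t * \<Phi> t) integrable_on {a..b}" by (intro integrable_continuous_real continuous_intros \<kappa> \<Phi>)
  have i3: "(\<lambda>t. \<kappa> t * \<Phi> t powr p) integrable_on {a..b}"
    using p \<Phi> by (intro integrable_continuous_real continuous_intros continuous_on_powr' \<kappa> \<Phi>) auto
  have m0: "0 \<le> m" unfolding m_def using \<kappa> \<Phi> by (intro Henstock_Kurzweil_Integration.integral_nonneg i2) auto
  show ?thesis
  proof (cases "m = 0")
    case True
    have "0 \<le> integral {a..b} (\<lambda>t. \<kappa> t * \<Phi> t powr p)"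
      using \<kappa> by (intro Henstock_Kurzweil_Integration.integral_nonneg i3) auto
    then show ?thesis using True unfolding m_def by simp
  next
    case False
    with m0 have m: "m > 0" by simp
    have eq: "\<kappa> t * (m powr p + p * m powr (p - 1) * (\<Phi> t - m)) = (m powr p - p * m powr (p - 1) * m) * \<kappa> t + p * m powr (p - 1) * (\<kappa> t * \<Phi> t)" for t
      by (simp add: algebra_simps)
    have hi: "((\<lambda>t. \<kappa> t * (m powr p + p * m powr (p - 1) * (\<Phi> t - m))) has_integral
      (m powr p - p * m powr (p - 1) * m) * 1 + p * m powr (p - 1) * m) {a..b}"
      unfolding eq by (intro has_integral_add has_integral_mult_right)
         (use integrable_integral[OF i1] integrable_integral[OF i2] \<kappa>(3) in \<open>simp_all add: m_def\<close>)
    have "(m powr p - p * m powr (p - 1) * m) * 1 + p * m powr (p - 1) * m \<le> integral {a..b} (\<lambda>t. \<kappa> t * \<Phi> t powr p)"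
      by (rule has_integral_le[OF hi integrable_integral[OF i3]])
        (use powr_above_tangent[OF \<Phi>(2) m p] \<kappa> in \<open>auto intro: mult_left_mono\<close>)
    then show ?thesis unfolding m_def by simp
  qed
qed

section \<open>Herglotz integrals\<close>

text \<open>The holomorphic function whose real part is the Poisson integral of \<open>\<Phi>\<close>.\<close>

definition herglotz :: "(real \<Rightarrow> real) \<Rightarrow> complex \<Rightarrow> complex"
  where "herglotz \<Phi> w = integral {0..2*pi} (\<lambda>t. herglotz_kernel w t * of_real (\<Phi> t / (2 * pi)))"

lemma continuous_herglotz_kernel_right:
  "w \<in> unit_disc \<Longrightarrow> continuous_on A (herglotz_kernel w)"
  unfolding herglotz_kernel_def
  by (intro continuous_intros) (use cis_minus_nonzero in auto)

lemma herglotz_integrable: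
  assumes "continuous_on {0..2*pi} \<Phi>" "w \<in> unit_disc"
  shows "(\<lambda>t. herglotz_kernel w t * of_real (\<Phi> t / (2 * pi))) integrable_on {0..2*pi}"
  by (intro integrable_continuous_real continuous_intros continuous_herglotz_kernel_right assms) auto

lemma herglotz_holomorphic:
  assumes "continuous_on {0..2*pi} \<Phi>"
  shows "herglotz \<Phi> holomorphic_on unit_disc"
proof -
  have "(\<lambda>w. integral (cbox 0 (2*pi)) (\<lambda>t. herglotz_kernel w t * of_real (\<Phi> t / (2 * pi)))) holomorphic_on unit_disc"
  proof (rule leibniz_rule_holomorphic)
    show "((\<lambda>w. herglotz_kernel w t * of_real (\<Phi> t / (2 * pi))) has_field_derivative
      2 * cis t / (cis t - w)\<^sup>2 * of_real (\<Phi> t / (2 * pi))) (at w within unit_disc)" if "w \<in> unit_disc" for w t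
      unfolding herglotz_kernel_def using cis_minus_nonzero[OF that, of t]
      by (auto intro!: derivative_eq_intros simp: power2_eq_square divide_simps) (simp add: algebra_simps)?
    show "continuous_on (unit_disc \<times> cbox 0 (2*pi)) (\<lambda>(w, t). 2 * cis t / (cis t - w)\<^sup>2 * of_real (\<Phi> t / (2 * pi)))"
      unfolding split_beta
      by (intro continuous_intros continuous_on_compose2[OF assms]) (use cis_minus_nonzero in auto)
  qed (use herglotz_integrable[OF assms] in auto)
  then show ?thesis by (simp add: herglotz_def[abs_def])
qed

lemma Re_herglotz:
  assumes "continuous_on {0..2*pi} \<Phi>" "w \<in> unit_disc"
  shows "((\<lambda>t. poisson_kernel w t / (2 * pi) * \<Phi> t) has_integral Re (herglotz \<Phi> w)) {0..2*pi}"
proof -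
  have "((\<lambda>t. herglotz_kernel w t * of_real (\<Phi> t / (2 * pi))) has_integral herglotz \<Phi> w) {0..2*pi}"
    unfolding herglotz_def by (intro integrable_integral herglotz_integrable assms)
  from has_integral_Re[OF this]
  have "((\<lambda>t. Re (herglotz_kernel w t * of_real (\<Phi> t / (2 * pi)))) has_integral Re (herglotz \<Phi> w)) {0..2*pi}" .
  moreover have eq: "Re (herglotz_kernel w t * of_real (\<Phi> t / (2 * pi))) = poisson_kernel w t / (2 * pi) * \<Phi> t" for t
    using Re_herglotz_kernel[OF assms(2), of t] by simp
  ultimately show ?thesis by (simp only: eq)
qed

lemma norm_herglotz_le:
  assumes \<Phi>: "continuous_on {0..2*pi} \<Phi>" "\<And>t. t \<in> {0..2*pi} \<Longrightarrow> 0 \<le> \<Phi> t" and w: "cmod w \<le> r" "r < 1"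
  shows "cmod (herglotz \<Phi> w) \<le> 2 / (1 - r) * integral {0..2*pi} \<Phi>"
proof -
  have wd: "w \<in> unit_disc" using w by auto
  have "cmod (herglotz \<Phi> w) \<le> integral {0..2*pi} (\<lambda>t. 2 / (1 - r) * \<Phi> t)"
    unfolding herglotz_def
  proof (rule integral_norm_bound_integral)
    show "(\<lambda>t. 2 / (1 - r) * \<Phi> t) integrable_on {0..2*pi}"
      by (intro integrable_continuous_real continuous_intros \<Phi>)
    fix t assume t: "t \<in> {0..2*pi}"
    have "cmod (cis t + w) \<le> 2" using norm_triangle_ineq[of "cis t" w] w by simp
    moreover have "1 - r \<le> cmod (cis t - w)" using norm_triangle_ineq2[of "cis t" w] w by simp
    ultimately have "cmod (herglotz_kernel w t) \<le> 2 / (1 - r)"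
      unfolding herglotz_kernel_def norm_divide using w by (intro frac_le) auto
    moreover have "\<Phi> t / (2 * pi) \<le> \<Phi> t / 1" using \<Phi>(2)[OF t] pi_gt3 by (intro divide_left_mono) auto
    ultimately have "cmod (herglotz_kernel w t) * (\<Phi> t / (2 * pi)) \<le> 2 / (1 - r) * \<Phi> t"
      using \<Phi>(2)[OF t] w by (intro mult_mono) auto
    then show "cmod (herglotz_kernel w t * of_real (\<Phi> t / (2 * pi))) \<le> 2 / (1 - r) * \<Phi> t"
      using \<Phi>(2)[OF t] by (simp add: norm_mult norm_divide)
  qed (rule herglotz_integrable[OF \<Phi>(1) wd])
  then show ?thesis by simp
qed

text \<open>
  Poisson averaging is a contraction in \<open>L\<^sup>p\<close>: Jensen's inequality for the probability density
  \<open>poisson_kernel w t / (2 * pi)\<close>, followed by Fubini and the symmetry of the kernel.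
\<close>

lemma herglotz_mean_le:
  assumes p: "1 \<le> p" and \<Phi>: "continuous_on {0..2*pi} \<Phi>" "\<And>t. t \<in> {0..2*pi} \<Longrightarrow> 0 \<le> \<Phi> t"
    and r: "0 \<le> r" "r < 1"
  shows "integral {0..2*pi} (\<lambda>s. Re (herglotz \<Phi> (of_real r * cis s)) powr p) \<le> integral {0..2*pi} (\<lambda>t. \<Phi> t powr p)"
proof -
  define \<kappa> where "\<kappa> s t = poisson_kernel (of_real r * cis s) t / (2 * pi)" for s t
  have d: "of_real r * cis s \<in> unit_disc" for s using r by (simp add: norm_mult)
  have \<kappa>_int: "integral {0..2*pi} (\<kappa> s) = 1" for s
    using has_integral_divide[OF poisson_kernel_integral[OF d[of s]], of "2*pi"] unfolding \<kappa>_def by (intro integral_unique) simp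
  have \<kappa>_swap: "\<kappa> s t = \<kappa> t s" for s t unfolding \<kappa>_def by (subst poisson_kernel_swap) simp
  have \<kappa>0: "0 \<le> \<kappa> s t" for s t unfolding \<kappa>_def using poisson_kernel_nonneg[OF d] by simp
  have \<kappa>_cont2: "continuous_on A (\<lambda>(s, t). \<kappa> s t)" for A
    unfolding \<kappa>_def poisson_kernel_def split_beta using cis_minus_nonzero[OF d]
    by (intro continuous_intros) auto
  have \<kappa>_cont: "continuous_on A (\<kappa> s)" for A s
    unfolding \<kappa>_def by (intro continuous_intros continuous_poisson_kernel_right d) auto
  have cp: "continuous_on {0..2*pi} (\<lambda>t. \<Phi> t powr p)" using p \<Phi> by (intro continuous_on_powr' continuous_intros) auto
  have cK: "continuous_on (cbox (0, 0) (2*pi, 2*pi)) (\<lambda>(s, t). \<kappa> s t * \<Phi> t powr p)"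
    using continuous_on_mult[OF \<kappa>_cont2 continuous_on_compose2[OF cp continuous_on_snd[OF continuous_on_id], of "cbox (0, 0) (2*pi, 2*pi)"]]
    by (auto simp: split_beta cbox_Pair_eq)
  have hol: "continuous_on {0..2*pi} (\<lambda>s. Re (herglotz \<Phi> (of_real r * cis s)))"
    by (intro continuous_intros continuous_on_compose2[OF holomorphic_on_imp_continuous_on[OF herglotz_holomorphic[OF \<Phi>(1)]]]) (use d in auto)
  have nn: "0 \<le> Re (herglotz \<Phi> (of_real r * cis s))" for s
    by (rule has_integral_nonneg[OF Re_herglotz[OF \<Phi>(1) d]]) (intro mult_nonneg_nonneg \<kappa>0[unfolded \<kappa>_def] \<Phi>)
  have "integral {0..2*pi} (\<lambda>s. Re (herglotz \<Phi> (of_real r * cis s)) powr p)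
      \<le> integral {0..2*pi} (\<lambda>s. integral {0..2*pi} (\<lambda>t. \<kappa> s t * \<Phi> t powr p))"
  proof (rule integral_le)
    show "(\<lambda>s. Re (herglotz \<Phi> (of_real r * cis s)) powr p) integrable_on {0..2*pi}"
      using p nn by (intro integrable_continuous_real continuous_on_powr' hol continuous_intros) auto
    show "(\<lambda>s. integral {0..2*pi} (\<lambda>t. \<kappa> s t * \<Phi> t powr p)) integrable_on {0..2*pi}"
      using integral_continuous_on_param[OF cK[unfolded cbox_Pair_eq]] by (intro integrable_continuous_real) simp
    fix s
    have "Re (herglotz \<Phi> (of_real r * cis s)) = integral {0..2*pi} (\<lambda>t. \<kappa> s t * \<Phi> t)"
      using integral_unique[OF Re_herglotz[OF \<Phi>(1) d[of s]]] by (simp add: \<kappa>_def)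
    then show "Re (herglotz \<Phi> (of_real r * cis s)) powr p \<le> integral {0..2*pi} (\<lambda>t. \<kappa> s t * \<Phi> t powr p)"
      using powr_integral_le_weighted[OF p \<kappa>_cont \<kappa>0 \<kappa>_int \<Phi>] by simp
  qed
  also have "\<dots> = integral {0..2*pi} (\<lambda>t. integral {0..2*pi} (\<lambda>s. \<kappa> s t * \<Phi> t powr p))"
    using integral_swap_continuous[OF cK] by simp
  also have "\<dots> = integral {0..2*pi} (\<lambda>t. \<Phi> t powr p)"
    by (subst \<kappa>_swap) (simp add: \<kappa>_int)
  finally show ?thesis .
qed

section \<open>A positive harmonic majorant of the data\<close>

text \<open>
  The square of the Szego kernel at \<open>a\<close>, normalized to take the value \<open>1\<close> at \<open>a\<close>. Squaring makes
  \<open>\<bar>peak a\<bar> powr p\<close>, for every \<open>p \<ge> 1\<close>, at most a constant times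
  \<open>1 - \<bar>a\<bar>\<^sup>2\<close> times a Poisson kernel.
\<close>

definition peak :: "complex \<Rightarrow> complex \<Rightarrow> complex"
  where "peak a w = (of_real (1 - (cmod a)\<^sup>2) / (1 - cnj a * w))\<^sup>2"

lemma peak_self: "a \<in> unit_disc \<Longrightarrow> peak a a = 1"
  using one_minus_cnj_mult_nonzero[of a a] complex_norm_square[of a] by (simp add: peak_def mult.commute)

lemma peak_holomorphic: "a \<in> unit_disc \<Longrightarrow> peak a holomorphic_on unit_disc"
  unfolding peak_def[abs_def] by (intro holomorphic_intros) (use one_minus_cnj_mult_nonzero in auto)

text \<open>
  The quotient \<open>x = (1 - \<bar>a\<bar>\<^sup>2) / \<bar>1 - cnj a * w\<bar>\<close> is at most \<open>2\<close>, so that \<open>(x\<^sup>2) powr p\<close> is controlled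
  by \<open>x\<^sup>2\<close>. On a circle, \<open>x\<^sup>2\<close> is at most \<open>1 - \<bar>a\<bar>\<^sup>2\<close> times the Poisson kernel, whose integral is known.
\<close>

lemma peak_powr_le_poisson:
  assumes a: "a \<in> unit_disc" and \<rho>: "0 < \<rho>" "\<rho> < 1" and p: "1 \<le> p"
  shows "cmod (peak a (of_real \<rho> * cis t)) powr p \<le> 4 powr p * ((1 - (cmod a)\<^sup>2) * poisson_kernel (of_real \<rho> * a) t)"
proof -
  define d where "d = cmod (cis t - of_real \<rho> * a)"
  define b where "b = 1 - (cmod a)\<^sup>2"
  define x where "x = b / d"
  have a1: "cmod a < 1" using a by simp
  have b: "0 < b" using a1 by (simp add: b_def power_less_one_iff abs_square_less_1)
  then have nb: "cmod (of_real b) = b" by simp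
  have \<rho>a: "cmod (of_real \<rho> * a) \<le> cmod a" using \<rho> by (simp add: norm_mult mult_left_le_one_le)
  have d_ge: "1 - cmod a \<le> d"
    using norm_triangle_ineq2[of "cis t" "of_real \<rho> * a"] \<rho>a unfolding d_def by simp
  have d: "0 < d" using d_ge a1 by simp
  have "cmod (1 - cnj a * (of_real \<rho> * cis t)) = d"
  proof -
    have "1 - cnj a * (of_real \<rho> * cis t) = cis t * cnj (cis t - of_real \<rho> * a)"
      by (simp add: algebra_simps cis_cnj cis_mult)
    then show ?thesis by (simp only: norm_mult norm_cis complex_mod_cnj mult_1 d_def)
  qed
  then have pk: "cmod (peak a (of_real \<rho> * cis t)) = x\<^sup>2"
    using nb unfolding peak_def norm_power norm_divide x_def b_def[symmetric] by simp
  have x0: "0 \<le> x" using b d by (simp add: x_def)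
  have "b = (1 - cmod a) * (1 + cmod a)" by (simp add: b_def power2_eq_square algebra_simps)
  also have "\<dots> \<le> d * 2" using d_ge a1 d by (intro mult_mono) auto
  finally have x2: "x \<le> 2" using d by (simp add: x_def field_simps)
  define y where "y = x\<^sup>2 / 4"
  have y: "0 \<le> y" "y \<le> 1" using power_mono[OF x2 x0, of 2] by (auto simp: y_def)
  have "x\<^sup>2 powr p = 4 powr p * y powr p" using y by (simp add: powr_mult[symmetric] y_def)
  also have "\<dots> \<le> 4 powr p * y"
  proof (intro mult_left_mono)
    show "y powr p \<le> y" using y p powr_mono'[of 1 p y] by simp
  qed auto
  also have "\<dots> \<le> 4 powr p * x\<^sup>2" using x0 by (intro mult_left_mono) (auto simp: y_def)
  also have "\<dots> \<le> 4 powr p * (b * poisson_kernel (of_real \<rho> * a) t)"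
  proof (intro mult_left_mono)
    have "b \<le> 1 - (cmod (of_real \<rho> * a))\<^sup>2" unfolding b_def using power_mono[OF \<rho>a, of 2] by simp
    then have "b * (b / d\<^sup>2) \<le> b * ((1 - (cmod (of_real \<rho> * a))\<^sup>2) / d\<^sup>2)"
      using b d by (intro mult_left_mono divide_right_mono) auto
    then show "x\<^sup>2 \<le> b * poisson_kernel (of_real \<rho> * a) t"
      unfolding poisson_kernel_def d_def[symmetric] x_def by (simp add: power2_eq_square)
  qed auto
  finally show ?thesis unfolding pk b_def .
qed

text \<open>
  A holomorphic function is the Poisson integral of its boundary values, so its modulus is dominated by
  the Poisson integral of any majorant of the boundary modulus. The dilation by \<open>\<rho>\<close> makes \<open>g\<close> continuous
  up to the circle.
\<close>

lemma poisson_majorant: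
  assumes g: "g holomorphic_on unit_disc" and \<rho>: "0 < \<rho>" "\<rho> < 1" and \<Phi>: "continuous_on {0..2*pi} \<Phi>"
    and le: "\<And>t. cmod (g (of_real \<rho> * cis t)) \<le> \<Phi> t" and w: "w \<in> unit_disc"
  shows "cmod (g (of_real \<rho> * w)) \<le> Re (herglotz \<Phi> w)"
proof -
  have sc: "of_real \<rho> * u \<in> unit_disc" if "u \<in> cball 0 1" for u
  proof -
    have "\<rho> * cmod u \<le> \<rho> * 1" using that \<rho> by (intro mult_left_mono) auto
    then have "\<rho> * cmod u < 1" using \<rho> by linarith
    then show ?thesis using \<rho> by (simp add: norm_mult)
  qed
  have gh: "(\<lambda>u. g (of_real \<rho> * u)) holomorphic_on unit_disc"
    by (rule holomorphic_on_compose_gen[OF _ g, of "\<lambda>u. of_real \<rho> * u", unfolded o_def])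
      (use sc in \<open>auto intro!: holomorphic_intros\<close>)
  have gc: "continuous_on (cball 0 1) (\<lambda>u. g (of_real \<rho> * u))"
    by (rule continuous_on_compose2[OF holomorphic_on_imp_continuous_on[OF g]]) (use sc in \<open>auto intro!: continuous_intros\<close>)
  note I = poisson_formula[OF gh gc w]
  note J = has_integral_mult_right[OF Re_herglotz[OF \<Phi> w], of "2 * pi"]
  have "cmod (integral {0..2*pi} (\<lambda>t. of_real (poisson_kernel w t) * g (of_real \<rho> * cis t)))
    \<le> integral {0..2*pi} (\<lambda>t. 2 * pi * (poisson_kernel w t / (2 * pi) * \<Phi> t))"
  proof (rule integral_norm_bound_integral)
    show "cmod (of_real (poisson_kernel w t) * g (of_real \<rho> * cis t)) \<le> 2 * pi * (poisson_kernel w t / (2 * pi) * \<Phi> t)" for t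
      using mult_left_mono[OF le[of t] poisson_kernel_nonneg[OF w, of t]] poisson_kernel_nonneg[OF w, of t] by (simp add: norm_mult)
  qed (use I J in \<open>blast intro: has_integral_integrable\<close>)+
  then show ?thesis unfolding integral_unique[OF I] integral_unique[OF J] by (simp add: norm_mult)
qed

lemma le_one_plus_powr: "1 \<le> p \<Longrightarrow> 0 \<le> x \<Longrightarrow> x \<le> 1 + x powr (p::real)"
  using powr_mono[of 1 p x] by (cases "x \<le> 1") (auto simp: add_increasing2)

text \<open>
  The construction of \<open>G\<close> for the points with index below \<open>N\<close>, with bounds independent of \<open>N\<close>. The
  loss of \<open>1\<close> in \<open>a k - 1\<close> pays for the dilation by a radius \<open>\<rho>\<close> close to \<open>1\<close>.
\<close>

lemma finite_positive_majorants:
  fixes a :: "nat \<Rightarrow> real"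
  assumes p: "1 \<le> p" and z: "interpolating_sequence K z" and a: "\<And>k. 0 \<le> a k"
    and A: "\<And>N. (\<Sum>k\<in>K \<inter> {..<N}. (1 - (cmod (z k))\<^sup>2) * a k powr p) \<le> A"
  shows "\<exists>C. \<forall>N. \<exists>G. G holomorphic_on unit_disc \<and> (\<forall>w\<in>unit_disc. 0 \<le> Re (G w)) \<and>
     (\<forall>k\<in>K \<inter> {..<N}. a k - 1 \<le> Re (G (z k))) \<and>
     (\<forall>r\<in>{0<..<1}. integral {0..2*pi} (\<lambda>t. Re (G (of_real r * cis t)) powr p) \<le> C) \<and>
     (\<forall>r<1. \<forall>w. cmod w \<le> r \<longrightarrow> cmod (G w) \<le> 2 / (1 - r) * (2 * pi + C))"
proof -
  obtain M where M: "M > 0" "\<And>N. \<exists>f :: nat \<Rightarrow> complex \<Rightarrow> complex.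
    (\<forall>k. f k holomorphic_on unit_disc) \<and>
    (\<forall>k<N. \<forall>l\<in>K. l < N \<longrightarrow> f k (z l) = (if k = l then 1 else 0)) \<and>
    (\<forall>w\<in>unit_disc. (\<Sum>k<N. cmod (f k w)) \<le> M)"
    by (rule beurling_functions[OF z]) (rule that, assumption+)
  have zK: "z k \<in> unit_disc" if "k \<in> K" for k
    using interpolating_sequence_in_disc[OF z] that by blast
  define C where "C = (M powr p * 4 powr p) * (2 * pi * A)"
  show ?thesis
  proof (intro exI[of _ C] allI)
    fix N
    define F where "F = K \<inter> {..<N}"
    have F: "finite F" "F \<subseteq> K" by (auto simp: F_def)
    obtain f where f: "\<And>k. f k holomorphic_on unit_disc"
      "\<And>k l. k \<in> F \<Longrightarrow> l \<in> F \<Longrightarrow> f k (z l) = (if k = l then 1 else 0)"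
      "\<And>w. w \<in> unit_disc \<Longrightarrow> (\<Sum>k<N. cmod (f k w)) \<le> M"
    proof -
      obtain f where "\<forall>k. f k holomorphic_on unit_disc"
        "\<forall>k<N. \<forall>l\<in>K. l < N \<longrightarrow> f k (z l) = (if k = l then 1 else 0)"
        "\<forall>w\<in>unit_disc. (\<Sum>k<N. cmod (f k w)) \<le> M"
        using M(2)[of N] by (elim exE conjE)
      then show ?thesis by (intro that[of f]) (simp_all add: F_def)
    qed
    have fM: "(\<Sum>k\<in>F. cmod (f k w)) \<le> M" if "w \<in> unit_disc" for w
    proof -
      have "(\<Sum>k\<in>F. cmod (f k w)) \<le> (\<Sum>k<N. cmod (f k w))"
        by (rule sum_mono2) (auto simp: F_def)
      then show ?thesis using f(3)[OF that] by linarith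
    qed
    define g where "g w = (\<Sum>k\<in>F. of_real (a k) * f k w * peak (z k) w)" for w
    have g: "g holomorphic_on unit_disc"
      unfolding g_def[abs_def] using zK F by (intro holomorphic_intros f(1) peak_holomorphic) auto
    have gz: "g (z l) = of_real (a l)" if l: "l \<in> F" for l
    proof -
      have "g (z l) = (\<Sum>k\<in>F. if k = l then of_real (a l) else 0)"
        unfolding g_def using f(2)[OF _ l] peak_self[OF zK] F(2) by (intro sum.cong) auto
      then show ?thesis using F(1) l by simp
    qed
    (* By continuity at the finitely many points, some dilation nearly keeps the values of g. *)
    have "eventually (\<lambda>\<rho>. 0 < \<rho> \<and> \<rho> < 1 \<and> (\<forall>l\<in>F. a l - 1 < cmod (g (of_real \<rho> * z l)))) (at_left (1::real))"
    proof (intro eventually_conj eventually_ball_finite F ballI)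
      show "eventually (\<lambda>\<rho>. 0 < \<rho>) (at_left (1::real))" using eventually_at_left_real[of 0 "1::real"] by (auto elim: eventually_mono)
      show "eventually (\<lambda>\<rho>. \<rho> < 1) (at_left (1::real))" by (simp add: eventually_at_filter)
      fix l assume l: "l \<in> F"
      have zl: "z l \<in> unit_disc" using l zK F by auto
      have "isCont g (z l)"
        using holomorphic_on_imp_continuous_on[OF g] zl by (simp add: continuous_on_eq_continuous_at)
      moreover have "((\<lambda>\<rho>. of_real \<rho> * z l) \<longlongrightarrow> of_real 1 * z l) (at_left (1::real))"
        by (intro tendsto_intros)
      ultimately have "((\<lambda>\<rho>. g (of_real \<rho> * z l)) \<longlongrightarrow> g (z l)) (at_left (1::real))"
        using isCont_tendsto_compose[of "z l" g "\<lambda>\<rho>. of_real \<rho> * z l" "at_left (1::real)"] by simp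
      then have "((\<lambda>\<rho>. cmod (g (of_real \<rho> * z l))) \<longlongrightarrow> cmod (g (z l))) (at_left (1::real))"
        by (rule tendsto_norm)
      moreover have "a l - 1 < cmod (g (z l))" unfolding gz[OF l] by simp
      ultimately show "eventually (\<lambda>\<rho>. a l - 1 < cmod (g (of_real \<rho> * z l))) (at_left (1::real))"
        by (rule order_tendstoD)
    qed
    from eventually_happens'[OF _ this]
    obtain \<rho> :: real where \<rho>: "0 < \<rho>" "\<rho> < 1" and g\<rho>: "\<And>l. l \<in> F \<Longrightarrow> a l - 1 < cmod (g (of_real \<rho> * z l))"
      by (auto simp: trivial_limit_at_left_real)
    have d: "of_real \<rho> * cis t \<in> unit_disc" for t using \<rho> by (simp add: norm_mult)
    define \<Phi> where "\<Phi> t = (\<Sum>k\<in>F. a k * cmod (f k (of_real \<rho> * cis t)) * cmod (peak (z k) (of_real \<rho> * cis t)))" for t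
    have circ: "continuous_on S (\<lambda>t. h (of_real \<rho> * cis t))" if "h holomorphic_on unit_disc" for h :: "complex \<Rightarrow> complex" and S
      by (rule continuous_on_compose2[OF holomorphic_on_imp_continuous_on[OF that]]) (use d in \<open>auto intro!: continuous_intros\<close>)
    have cpk: "continuous_on S (\<lambda>t. peak (z k) (of_real \<rho> * cis t))" if "k \<in> F" for k S
      by (rule circ[OF peak_holomorphic]) (use zK F that in auto)
    have \<Phi>c: "continuous_on {0..2*pi} \<Phi>"
      unfolding \<Phi>_def[abs_def] by (intro continuous_on_sum continuous_on_mult continuous_on_const continuous_on_norm circ[OF f(1)] cpk)
    have \<Phi>0: "0 \<le> \<Phi> t" for t unfolding \<Phi>_def using a F by (intro sum_nonneg mult_nonneg_nonneg) auto
    (* Jensen's inequality with the weights \<bar>f k\<bar> / M, whose sum is at most 1. *)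
    have \<Phi>p: "\<Phi> t powr p \<le> (\<Sum>k\<in>F. M powr p * 4 powr p * a k powr p * (1 - (cmod (z k))\<^sup>2) * poisson_kernel (of_real \<rho> * z k) t)" for t
    proof -
      define w where "w = of_real \<rho> * cis t"
      have s1: "(\<Sum>k\<in>F. cmod (f k w) / M) \<le> 1" using fM[OF d] M(1) by (simp add: w_def sum_divide_distrib[symmetric])
      have "cmod (f k w) \<le> M" if "k \<in> F" for k
      proof -
        have "cmod (f k w) \<le> (\<Sum>k\<in>F. cmod (f k w))" using that F(1) by (intro member_le_sum) auto
        also have "\<dots> \<le> M" unfolding w_def by (rule fM[OF d])
        finally show ?thesis .
      qed
      then have f1: "cmod (f k w) / M \<le> 1" if "k \<in> F" for k using that M(1) by simp
      have "\<Phi> t = (\<Sum>k\<in>F. cmod (f k w) / M * (M * a k * cmod (peak (z k) w)))"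
        unfolding \<Phi>_def w_def[symmetric] using M(1) by (intro sum.cong) auto
      also have "\<dots> powr p \<le> (\<Sum>k\<in>F. cmod (f k w) / M * (M * a k * cmod (peak (z k) w)) powr p)"
        using M(1) a F by (intro powr_sum_le_weighted p s1) auto
      also have "\<dots> \<le> (\<Sum>k\<in>F. M powr p * 4 powr p * a k powr p * (1 - (cmod (z k))\<^sup>2) * poisson_kernel (of_real \<rho> * z k) t)"
      proof (rule sum_mono)
        fix k assume k: "k \<in> F"
        have "cmod (f k w) / M * (M * a k * cmod (peak (z k) w)) powr p \<le> 1 * (M * a k * cmod (peak (z k) w)) powr p"
          using f1[OF k] by (intro mult_right_mono) auto
        also have "\<dots> = M powr p * a k powr p * cmod (peak (z k) w) powr p"
          using M(1) a k F by (simp add: powr_mult)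
        also have "\<dots> \<le> M powr p * a k powr p * (4 powr p * ((1 - (cmod (z k))\<^sup>2) * poisson_kernel (of_real \<rho> * z k) t))"
          unfolding w_def using k F zK by (intro mult_left_mono peak_powr_le_poisson \<rho> p) auto
        finally show "cmod (f k w) / M * (M * a k * cmod (peak (z k) w)) powr p \<le> M powr p * 4 powr p * a k powr p * (1 - (cmod (z k))\<^sup>2) * poisson_kernel (of_real \<rho> * z k) t"
          by (simp only: mult_ac)
      qed
      finally show ?thesis .
    qed
    have cp: "continuous_on {0..2*pi} (\<lambda>t. \<Phi> t powr p)" using p \<Phi>0 by (intro continuous_on_powr' continuous_intros \<Phi>c) auto
    have "integral {0..2*pi} (\<lambda>t. \<Phi> t powr p) \<le> (\<Sum>k\<in>F. M powr p * 4 powr p * a k powr p * (1 - (cmod (z k))\<^sup>2) * (2 * pi))"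
    proof (rule has_integral_le[OF integrable_integral[OF integrable_continuous_real[OF cp]] _ \<Phi>p])
      have "of_real \<rho> * z k \<in> unit_disc" if "k \<in> F" for k
      proof -
        have "cmod (z k) < 1" using zK that F by auto
        then show ?thesis using \<rho> mult_left_le_one_le[of "cmod (z k)" \<rho>] by (simp add: norm_mult)
      qed
      then show "((\<lambda>t. \<Sum>k\<in>F. M powr p * 4 powr p * a k powr p * (1 - (cmod (z k))\<^sup>2) * poisson_kernel (of_real \<rho> * z k) t) has_integral
          (\<Sum>k\<in>F. M powr p * 4 powr p * a k powr p * (1 - (cmod (z k))\<^sup>2) * (2 * pi))) {0..2*pi}"
        by (intro has_integral_sum F has_integral_mult_right poisson_kernel_integral)
    qed
    also have "\<dots> = (M powr p * 4 powr p) * (2 * pi * (\<Sum>k\<in>F. (1 - (cmod (z k))\<^sup>2) * a k powr p))"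
      by (simp only: sum_distrib_left mult_ac)
    also have "\<dots> \<le> C" unfolding C_def F_def by (intro mult_left_mono A) auto
    finally have \<Phi>C: "integral {0..2*pi} (\<lambda>t. \<Phi> t powr p) \<le> C" .
    (* The integral of \<Phi> itself bounds its Herglotz integral on compact sets. *)
    have "integral {0..2*pi} \<Phi> \<le> integral {0..2*pi} (\<lambda>t. 1 + \<Phi> t powr p)"
      using le_one_plus_powr[OF p \<Phi>0] by (intro integral_le integrable_continuous_real continuous_intros \<Phi>c cp)
    also have "\<dots> = 2 * pi + integral {0..2*pi} (\<lambda>t. \<Phi> t powr p)"
      by (subst Henstock_Kurzweil_Integration.integral_add) (auto intro!: integrable_continuous_real cp)
    also have "\<dots> \<le> 2 * pi + C" using \<Phi>C by simp
    finally have \<Phi>1: "integral {0..2*pi} \<Phi> \<le> 2 * pi + C" .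
    have maj: "cmod (g (of_real \<rho> * w)) \<le> Re (herglotz \<Phi> w)" if "w \<in> unit_disc" for w
    proof (rule poisson_majorant[OF g \<rho> \<Phi>c _ that])
      show "cmod (g (of_real \<rho> * cis t)) \<le> \<Phi> t" for t
        unfolding g_def \<Phi>_def by (rule sum_norm_le) (use a F in \<open>auto simp: norm_mult\<close>)
    qed
    have m2: "a k - 1 \<le> Re (herglotz \<Phi> (z k))" if "k \<in> K \<inter> {..<N}" for k
    proof -
      have k: "k \<in> K" "k \<in> F" using that by (auto simp: F_def)
      show ?thesis using maj[OF zK[OF k(1)]] g\<rho>[OF k(2)] by linarith
    qed
    have m1: "0 \<le> Re (herglotz \<Phi> w)" if "w \<in> unit_disc" for w
      by (rule order_trans[OF norm_ge_zero maj[OF that]])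
    have m3: "integral {0..2*pi} (\<lambda>t. Re (herglotz \<Phi> (of_real r * cis t)) powr p) \<le> C" if "r \<in> {0<..<1}" for r
      using herglotz_mean_le[OF p \<Phi>c \<Phi>0, of r] \<Phi>C that by simp
    have m4: "cmod (herglotz \<Phi> w) \<le> 2 / (1 - r) * (2 * pi + C)" if "r < 1" "cmod w \<le> r" for r w
    proof -
      have "cmod (herglotz \<Phi> w) \<le> 2 / (1 - r) * integral {0..2*pi} \<Phi>"
        by (rule norm_herglotz_le[OF \<Phi>c \<Phi>0 that(2,1)])
      also have "\<dots> \<le> 2 / (1 - r) * (2 * pi + C)" using \<Phi>1 that by (intro mult_left_mono) auto
      finally show ?thesis .
    qed
    show "\<exists>G. G holomorphic_on unit_disc \<and> (\<forall>w\<in>unit_disc. 0 \<le> Re (G w)) \<and>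
     (\<forall>k\<in>K \<inter> {..<N}. a k - 1 \<le> Re (G (z k))) \<and>
     (\<forall>r\<in>{0<..<1}. integral {0..2*pi} (\<lambda>t. Re (G (of_real r * cis t)) powr p) \<le> C) \<and>
     (\<forall>r<1. \<forall>w. cmod w \<le> r \<longrightarrow> cmod (G w) \<le> 2 / (1 - r) * (2 * pi + C))"
      by (intro exI[of _ "herglotz \<Phi>"] conjI ballI allI impI)
        (rule herglotz_holomorphic[OF \<Phi>c] | erule m1 | erule m2 | erule m3 | erule (1) m4)+
  qed
qed

text \<open>
  A locally uniformly bounded subsequence of the functions for finitely many points converges, and all
  the inequalities survive in the limit; for the means this is dominated convergence on a fixed circle.
\<close>

lemma positive_majorant:
  fixes a :: "nat \<Rightarrow> real"
  assumes p: "1 \<le> p" and z: "interpolating_sequence K z" and a: "\<And>k. 0 \<le> a k"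
    and A: "\<And>N. (\<Sum>k\<in>K \<inter> {..<N}. (1 - (cmod (z k))\<^sup>2) * a k powr p) \<le> A"
  obtains G C where "G holomorphic_on unit_disc" "\<And>w. w \<in> unit_disc \<Longrightarrow> 0 \<le> Re (G w)"
    "\<And>k. k \<in> K \<Longrightarrow> a k - 1 \<le> Re (G (z k))"
    "\<And>r. r \<in> {0<..<1} \<Longrightarrow> integral {0..2*pi} (\<lambda>t. Re (G (of_real r * cis t)) powr p) \<le> C"
proof -
  have zK: "z k \<in> unit_disc" if "k \<in> K" for k
    using interpolating_sequence_in_disc[OF z] that by blast
  obtain C where "\<forall>N. \<exists>G. G holomorphic_on unit_disc \<and> (\<forall>w\<in>unit_disc. 0 \<le> Re (G w)) \<and>
     (\<forall>k\<in>K \<inter> {..<N}. a k - 1 \<le> Re (G (z k))) \<and>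
     (\<forall>r\<in>{0<..<1}. integral {0..2*pi} (\<lambda>t. Re (G (of_real r * cis t)) powr p) \<le> C) \<and>
     (\<forall>r<1. \<forall>w. cmod w \<le> r \<longrightarrow> cmod (G w) \<le> 2 / (1 - r) * (2 * pi + C))"
    using finite_positive_majorants[OF p z a A] by (elim exE)
  from choice[OF this] obtain H where H0: "\<forall>N. H N holomorphic_on unit_disc \<and> (\<forall>w\<in>unit_disc. 0 \<le> Re (H N w)) \<and>
     (\<forall>k\<in>K \<inter> {..<N}. a k - 1 \<le> Re (H N (z k))) \<and>
     (\<forall>r\<in>{0<..<1}. integral {0..2*pi} (\<lambda>t. Re (H N (of_real r * cis t)) powr p) \<le> C) \<and>
     (\<forall>r<1. \<forall>w. cmod w \<le> r \<longrightarrow> cmod (H N w) \<le> 2 / (1 - r) * (2 * pi + C))"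
    by (elim exE)
  have H: "\<And>N. H N holomorphic_on unit_disc" "\<And>N w. w \<in> unit_disc \<Longrightarrow> 0 \<le> Re (H N w)"
     "\<And>N k. k \<in> K \<Longrightarrow> k < N \<Longrightarrow> a k - 1 \<le> Re (H N (z k))"
     "\<And>N r. r \<in> {0<..<1} \<Longrightarrow> integral {0..2*pi} (\<lambda>t. Re (H N (of_real r * cis t)) powr p) \<le> C"
     "\<And>N r w. r < 1 \<Longrightarrow> cmod w \<le> r \<Longrightarrow> cmod (H N w) \<le> 2 / (1 - r) * (2 * pi + C)"
    using H0 by simp_all
  obtain G \<sigma> where G: "G holomorphic_on unit_disc" "strict_mono (\<sigma> :: nat \<Rightarrow> nat)"
    "\<And>w. w \<in> unit_disc \<Longrightarrow> (\<lambda>n. H (\<sigma> n) w) \<longlonglongrightarrow> G w"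
  proof (rule montel_disc[of H "\<lambda>r. 2 / (1 - r) * (2 * pi + C)"])
    show "H n holomorphic_on unit_disc" for n by (rule H)
    show "cmod (H n w) \<le> 2 / (1 - r) * (2 * pi + C)" if "0 < r" "r < 1" "cmod w \<le> r" for n r w
      using that by (intro H)
  qed (rule that)
  have ReG: "(\<lambda>n. Re (H (\<sigma> n) w)) \<longlonglongrightarrow> Re (G w)" if "w \<in> unit_disc" for w
    by (intro tendsto_Re G that)
  show ?thesis
  proof (rule that[of G C])
    show "G holomorphic_on unit_disc" by (rule G)
    show "0 \<le> Re (G w)" if "w \<in> unit_disc" for w
      by (rule LIMSEQ_le_const[OF ReG[OF that]]) (use H(2)[OF that] in auto)
    show "a k - 1 \<le> Re (G (z k))" if k: "k \<in> K" for k
    proof (rule LIMSEQ_le_const[OF ReG[OF zK[OF k]]], intro exI[of _ "Suc k"] allI impI)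
      fix n assume "Suc k \<le> n"
      then show "a k - 1 \<le> Re (H (\<sigma> n) (z k))" using seq_suble[OF G(2), of n] by (intro H k) simp
    qed
    fix r :: real assume r: "r \<in> {0<..<1}"
    define D where "D = 2 / (1 - r) * (2 * pi + C)"
    have d: "of_real r * cis t \<in> unit_disc" for t using r by (simp add: norm_mult)
    have "(\<lambda>n. integral {0..2*pi} (\<lambda>t. Re (H (\<sigma> n) (of_real r * cis t)) powr p))
        \<longlonglongrightarrow> integral {0..2*pi} (\<lambda>t. Re (G (of_real r * cis t)) powr p)"
    proof (rule dominated_convergence(2))
      fix n
      have "continuous_on {0..2*pi} (\<lambda>t. H (\<sigma> n) (of_real r * cis t))"
        by (rule continuous_on_compose2[OF holomorphic_on_imp_continuous_on[OF H(1)]]) (use d in \<open>auto intro!: continuous_intros\<close>)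
      then show "(\<lambda>t. Re (H (\<sigma> n) (of_real r * cis t)) powr p) integrable_on {0..2*pi}"
        using p H(2)[OF d] by (intro integrable_continuous_real continuous_on_powr' continuous_intros) auto
      show "(\<lambda>t. D powr p) integrable_on {0..2*pi}" by (intro integrable_continuous_real continuous_intros)
      fix t
      have "Re (H (\<sigma> n) (of_real r * cis t)) \<le> D"
        using H(5)[of r "of_real r * cis t" "\<sigma> n"] complex_Re_le_cmod[of "H (\<sigma> n) (of_real r * cis t)"] r
        by (simp add: D_def norm_mult)
      then have "Re (H (\<sigma> n) (of_real r * cis t)) powr p \<le> D powr p"
        using p H(2)[OF d] by (intro powr_mono2) auto
      then show "norm (Re (H (\<sigma> n) (of_real r * cis t)) powr p) \<le> D powr p" by simp
    next
      fix t
      show "(\<lambda>n. Re (H (\<sigma> n) (of_real r * cis t)) powr p) \<longlonglongrightarrow> Re (G (of_real r * cis t)) powr p"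
        by (intro tendsto_powr' ReG d tendsto_const) (use p H(2)[OF d] in auto)
    qed
    then show "integral {0..2*pi} (\<lambda>t. Re (G (of_real r * cis t)) powr p) \<le> C"
      by (rule LIMSEQ_le_const2) (use H(4)[OF r] in auto)
  qed
qed

section \<open>Division by a Blaschke product\<close>

lemma blaschke_factor_eq_0_iff: 
  assumes "a \<in> unit_disc" "w \<in> unit_disc"
  shows "blaschke_factor a w = 0 \<longleftrightarrow> w = a"
  using one_minus_cnj_mult_nonzero[of a w] assms by (auto simp: blaschke_factor_def)

lemma norm_blaschke_factor:
  "a \<in> unit_disc \<Longrightarrow> w \<in> unit_disc \<Longrightarrow> cmod (blaschke_factor a w) = cmod (Moebius_function 0 a w)"
  by (auto simp: blaschke_factor_def Moebius_function_simple norm_mult norm_divide norm_minus_commute)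

text \<open>
  The Schwarz lemma, transported from the origin to \<open>a\<close> by a Moebius transformation. That lemma
  asks for a strict bound, whence the detour through \<open>M' > M\<close>.
\<close>

lemma schwarz_pick_zero:
  assumes f: "f holomorphic_on unit_disc" "\<And>w. w \<in> unit_disc \<Longrightarrow> cmod (f w) \<le> M"
    and a: "a \<in> unit_disc" "f a = 0" and w: "w \<in> unit_disc"
  shows "cmod (f w) \<le> M * cmod (blaschke_factor a w)"
proof (rule field_le_epsilon)
  have M: "0 \<le> M" using f(2)[OF w] norm_ge_zero order_trans by blast
  have strict: "cmod (f w) \<le> M' * cmod (Moebius_function 0 a w)" if M': "M < M'" for M'
  proof -
    have M'0: "0 < M'" using M M' by linarith
    have a': "- a \<in> unit_disc" using a by simp
    have inv: "Moebius_function 0 (- a) (Moebius_function 0 a w) = w"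
      by (rule Moebius_function_compose) (use a w in auto)
    define F where "F u = f (Moebius_function 0 (- a) u) / of_real M'" for u
    have mob: "Moebius_function 0 (- a) u \<in> unit_disc" if "u \<in> unit_disc" for u
      using Moebius_function_norm_lt_1[of "- a" u 0] a that by simp
    have "(\<lambda>u. f (Moebius_function 0 (- a) u)) holomorphic_on unit_disc"
      by (rule holomorphic_on_compose_gen[OF Moebius_function_holomorphic f(1), unfolded o_def]) (use a mob in auto)
    then have F: "F holomorphic_on unit_disc" unfolding F_def[abs_def] using M'0 by (intro holomorphic_intros) auto
    have "cmod (F (Moebius_function 0 a w)) \<le> cmod (Moebius_function 0 a w)"
    proof (rule Schwarz_Lemma(1)[OF F])
      show "F 0 = 0" by (simp add: F_def Moebius_function_of_zero a)
      show "cmod (F u) < 1" if "cmod u < 1" for u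
      proof -
        have "cmod (f (Moebius_function 0 (- a) u)) < M'" using f(2)[OF mob, of u] that M' by simp
        then show ?thesis unfolding F_def using M'0 by (simp add: norm_divide)
      qed
      show "cmod (Moebius_function 0 a w) < 1" using Moebius_function_norm_lt_1[of a w 0] a w by simp
    qed
    then show ?thesis unfolding F_def inv using M'0 by (simp add: norm_divide field_simps)
  qed
  fix e :: real assume e: "0 < e"
  have "cmod (Moebius_function 0 a w) < 1" using Moebius_function_norm_lt_1[of a w 0] a w by simp
  then have "e * cmod (Moebius_function 0 a w) \<le> e * 1" using e by (intro mult_left_mono) auto
  moreover have "cmod (f w) \<le> M * cmod (Moebius_function 0 a w) + e * cmod (Moebius_function 0 a w)"
    using strict[of "M + e"] e by (simp add: algebra_simps)
  ultimately show "cmod (f w) \<le> M * cmod (blaschke_factor a w) + e"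
    unfolding norm_blaschke_factor[OF a(1) w] by linarith
qed

text \<open>
  Division by a Blaschke factor does not increase the supremum norm. Away from \<open>a\<close> this is the
  preceding lemma, and at \<open>a\<close> it follows by continuity.
\<close>

lemma divide_blaschke_factor:
  assumes f: "f holomorphic_on unit_disc" "\<And>w. w \<in> unit_disc \<Longrightarrow> cmod (f w) \<le> M"
    and a: "a \<in> unit_disc" "f a = 0"
  obtains h where "h holomorphic_on unit_disc" "\<And>w. w \<in> unit_disc \<Longrightarrow> cmod (h w) \<le> M"
    "\<And>w. w \<in> unit_disc \<Longrightarrow> f w = blaschke_factor a w * h w"
proof -
  define q where "q w = (if w = a then deriv f a else (f w - f a) / (w - a))" for w
  have q: "q holomorphic_on unit_disc" unfolding q_def[abs_def] by (rule pole_lemma_open[OF f(1)]) auto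
  have fq: "f w = (w - a) * q w" for w using a by (simp add: q_def)
  define u where "u = (if a = 0 then 1 else - (a / of_real (cmod a)))"
  define h where "h w = u * (1 - cnj a * w) * q w" for w
  have h: "h holomorphic_on unit_disc" unfolding h_def[abs_def] by (intro holomorphic_intros q)
  have fh: "f w = blaschke_factor a w * h w" if "w \<in> unit_disc" for w
    using one_minus_cnj_mult_nonzero[OF a(1), of w] that
    unfolding fq[of w] h_def u_def blaschke_factor_def by (auto simp: field_simps)
  have off: "cmod (h w) \<le> M" if "w \<in> unit_disc" "w \<noteq> a" for w
  proof -
    have "cmod (blaschke_factor a w) * cmod (h w) \<le> cmod (blaschke_factor a w) * M"
      using schwarz_pick_zero[OF f a that(1)] fh[OF that(1)] by (simp add: norm_mult mult.commute)
    moreover have "0 < cmod (blaschke_factor a w)" using blaschke_factor_eq_0_iff[OF a(1) that(1)] that(2) by simp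
    ultimately show ?thesis by simp
  qed
  have at_a: "cmod (h a) \<le> M"
  proof -
    have "isCont h a" using holomorphic_on_imp_continuous_on[OF h] a by (simp add: continuous_on_eq_continuous_at)
    then have "(h \<longlongrightarrow> h a) (at a)" by (simp add: isCont_def)
    then have "((\<lambda>w. cmod (h w)) \<longlongrightarrow> cmod (h a)) (at a)" by (rule tendsto_norm)
    moreover have "eventually (\<lambda>w. cmod (h w) \<le> M) (at a)"
      using eventually_at_in_open[OF open_ball a(1)] by eventually_elim (use off in auto)
    ultimately show ?thesis by (rule tendsto_upperbound) simp
  qed
  show ?thesis
  proof (rule that[OF h])
    show "cmod (h w) \<le> M" if "w \<in> unit_disc" for w using off[OF that] at_a by (cases "w = a") auto
  qed (rule fh)
qed

text \<open>
  The factors are divided out one at a time. Since the points are distinct, the earlier factors do not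
  vanish at the next point, so the quotient still does.
\<close>

lemma divide_partial_blaschke_product:
  fixes N :: nat
  assumes f: "f holomorphic_on unit_disc" "\<And>w. w \<in> unit_disc \<Longrightarrow> cmod (f w) \<le> M"
    and z: "z ` K \<subseteq> unit_disc" "inj_on z K" and f0: "\<And>k. k \<in> K \<Longrightarrow> f (z k) = 0"
  shows "\<exists>h. h holomorphic_on unit_disc \<and> (\<forall>w\<in>unit_disc. cmod (h w) \<le> M) \<and>
    (\<forall>w\<in>unit_disc. f w = (\<Prod>k<N. if k \<in> K then blaschke_factor (z k) w else 1) * h w)"
proof (induction N)
  case 0
  then show ?case using f by (intro exI[of _ f]) simp
next
  case (Suc N)
  then obtain h where h: "h holomorphic_on unit_disc" "\<And>w. w \<in> unit_disc \<Longrightarrow> cmod (h w) \<le> M"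
    "\<And>w. w \<in> unit_disc \<Longrightarrow> f w = (\<Prod>k<N. if k \<in> K then blaschke_factor (z k) w else 1) * h w"
    by (elim exE conjE) (rule that, auto)
  show ?case
  proof (cases "N \<in> K")
    case True
    have zN: "z N \<in> unit_disc" using z True by blast
    have "(if k \<in> K then blaschke_factor (z k) (z N) else 1) \<noteq> 0" if "k < N" for k
    proof (cases "k \<in> K")
      case k: True
      then have "z k \<noteq> z N" using inj_onD[OF z(2) _ k True] that by auto
      then show ?thesis using k blaschke_factor_eq_0_iff[of "z k" "z N"] zN z(1) by auto
    qed simp
    then have "(\<Prod>k<N. if k \<in> K then blaschke_factor (z k) (z N) else 1) \<noteq> 0" by (simp only: prod_zero_iff finite_lessThan) auto
    with h(3)[OF zN] f0[OF True] have h0: "h (z N) = 0" by simp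
    obtain h' where h': "h' holomorphic_on unit_disc" "\<And>w. w \<in> unit_disc \<Longrightarrow> cmod (h' w) \<le> M"
      "\<And>w. w \<in> unit_disc \<Longrightarrow> h w = blaschke_factor (z N) w * h' w"
      by (rule divide_blaschke_factor[of h M "z N", OF h(1) _ zN h0]) (erule h(2), rule that, assumption+)
    show ?thesis
      by (intro exI[of _ h'] conjI ballI h') (use h(3) h'(3) True in simp_all)
  next
    case False
    then show ?thesis using h by (intro exI[of _ h]) simp
  qed
qed

lemma one_minus_blaschke_factor_le:
  assumes a: "a \<in> unit_disc" and w: "cmod w \<le> r" "r < 1"
  shows "cmod (blaschke_factor a w - 1) \<le> (2 / (1 - r)) * (1 - cmod a)"
proof (cases "a = 0")
  case True
  have "0 \<le> r" using w norm_ge_zero order_trans by blast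
  then have "2 \<le> 2 / (1 - r)" using w by (simp add: field_simps)
  moreover have "cmod (w - 1) \<le> 2" using norm_triangle_ineq4[of w 1] w by simp
  ultimately show ?thesis using True by (simp add: blaschke_factor_def)
next
  case False
  define d where "d = 1 - cnj a * w"
  define c where "c = complex_of_real (cmod a) / a"
  have r0: "0 \<le> r" using w norm_ge_zero order_trans by blast
  have c: "cmod c = 1" using False by (simp add: c_def norm_divide)
  have a1: "cmod a < 1" using a by simp
  have "cmod a * cmod w \<le> 1 * r" using w a1 r0 by (intro mult_mono) auto
  then have d: "1 - r \<le> cmod d" unfolding d_def using norm_triangle_ineq2[of 1 "cnj a * w"] by (simp add: norm_mult)
  then have d0: "d \<noteq> 0" using w by auto
  have ca: "c * a = of_real (cmod a)" "of_real (cmod a) * c = cnj a"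
    using False by (auto simp: c_def field_simps complex_norm_square[symmetric] power2_eq_square[symmetric])
  have "blaschke_factor a w = c * (a - w) / d"
    using False by (simp add: blaschke_factor_def c_def d_def)
  then have "blaschke_factor a w - 1 = (c * (a - w) - d) / d"
    using d0 by (simp add: diff_divide_distrib)
  also have "c * (a - w) - d = - (1 - of_real (cmod a)) * (1 + c * w)"
    unfolding d_def ca(2)[symmetric] using ca(1) by (simp add: algebra_simps)
  finally have "cmod (blaschke_factor a w - 1) = (1 - cmod a) * cmod (1 + c * w) / cmod d"
  proof -
    have "cmod (- (1 - of_real (cmod a))) = 1 - cmod a"
      using a1 by (metis abs_of_nonneg diff_ge_0_iff_ge less_imp_le norm_minus_cancel norm_of_real of_real_1 of_real_diff)
    then show "blaschke_factor a w - 1 = - (1 - of_real (cmod a)) * (1 + c * w) / d \<Longrightarrow> ?thesis"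
      by (simp only: norm_mult norm_divide)
  qed
  also have "\<dots> \<le> (1 - cmod a) * 2 / (1 - r)"
  proof (intro frac_le mult_left_mono)
    show "cmod (1 + c * w) \<le> 2" using norm_triangle_ineq[of 1 "c * w"] c w by (simp add: norm_mult)
  qed (use a1 d w in auto)
  finally show ?thesis by (simp add: mult.commute)
qed

lemma blaschke_partial_products_tendsto:
  assumes z: "z ` K \<subseteq> unit_disc" and s: "(\<lambda>k. 1 - cmod (z k)) summable_on K" and w: "w \<in> unit_disc"
  shows "(\<lambda>N. \<Prod>k<N. if k \<in> K then blaschke_factor (z k) w else 1) \<longlonglongrightarrow>
    (\<Prod>k. if k \<in> K then blaschke_factor (z k) w else 1)"
proof -
  define b where "b k = (if k \<in> K then blaschke_factor (z k) w else 1)" for k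
  define e where "e k = (if k \<in> K then 1 - cmod (z k) else 0)" for k
  have "e summable_on UNIV"
    by (rule summable_on_cong_neutral[THEN iffD1, OF _ _ _ s]) (auto simp: e_def)
  then have "summable e" by (rule summable_on_imp_summable)
  then have "summable (\<lambda>k. (2 / (1 - cmod w)) * e k)" by (rule summable_mult)
  then have "summable (\<lambda>k. cmod (b k - 1))"
  proof (rule summable_comparison_test')
    show "norm (cmod (b k - 1)) \<le> (2 / (1 - cmod w)) * e k" for k
      using one_minus_blaschke_factor_le[of "z k" w "cmod w"] z w by (auto simp: b_def e_def)
  qed
  then have "convergent_prod b"
    by (intro abs_convergent_prod_imp_convergent_prod summable_imp_abs_convergent_prod)
  from convergent_prod_LIMSEQ[OF this] have "(\<lambda>N. \<Prod>k<N. b k) \<longlonglongrightarrow> prodinf b"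
    by (simp only: LIMSEQ_lessThan_iff_atMost)
  then show ?thesis unfolding b_def .
qed

text \<open>
  The quotients by the partial products have a common bound, so a subsequence converges; its limit is
  the quotient by the infinite product because the partial products converge to it pointwise.
\<close>

lemma divide_blaschke_product:
  assumes f: "f holomorphic_on unit_disc" "\<And>w. w \<in> unit_disc \<Longrightarrow> cmod (f w) \<le> M"
    and B: "blaschke_product K z B" and inj: "inj_on z K" and f0: "\<And>k. k \<in> K \<Longrightarrow> f (z k) = 0"
  obtains h where "h holomorphic_on unit_disc" "\<And>w. w \<in> unit_disc \<Longrightarrow> cmod (h w) \<le> M"
    "\<And>w. w \<in> unit_disc \<Longrightarrow> f w = B w * h w"
proof -
  let ?P = "\<lambda>N w. \<Prod>k<N. if k \<in> K then blaschke_factor (z k) w else 1"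
  obtain c where zK: "z ` K \<subseteq> unit_disc" and s: "(\<lambda>k. 1 - cmod (z k)) summable_on K" and c: "cmod c = 1"
    and Bc: "B = (\<lambda>w\<in>unit_disc. c * (\<Prod>k. if k \<in> K then blaschke_factor (z k) w else 1))"
    using B unfolding blaschke_product_def by (elim exE conjE)
  have "\<forall>N. \<exists>h. h holomorphic_on unit_disc \<and> (\<forall>w\<in>unit_disc. cmod (h w) \<le> M) \<and>
    (\<forall>w\<in>unit_disc. f w = ?P N w * h w)"
    by (intro allI divide_partial_blaschke_product f zK inj f0)
  from choice[OF this] obtain H where H: "\<forall>N. H N holomorphic_on unit_disc \<and> (\<forall>w\<in>unit_disc. cmod (H N w) \<le> M) \<and>
    (\<forall>w\<in>unit_disc. f w = ?P N w * H N w)" by (elim exE)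
  obtain h \<sigma> where h: "h holomorphic_on unit_disc" "\<And>w. w \<in> unit_disc \<Longrightarrow> cmod (h w) \<le> M"
    "strict_mono (\<sigma> :: nat \<Rightarrow> nat)" "\<And>w. w \<in> unit_disc \<Longrightarrow> (\<lambda>n. H (\<sigma> n) w) \<longlonglongrightarrow> h w"
    by (rule montel_disc_bounded[of H M]) (use H in blast, use H in blast, rule that, assumption+)
  have fh: "f w = (\<Prod>k. if k \<in> K then blaschke_factor (z k) w else 1) * h w" if w: "w \<in> unit_disc" for w
  proof (rule LIMSEQ_unique)
    show "(\<lambda>n. ?P (\<sigma> n) w * H (\<sigma> n) w) \<longlonglongrightarrow> (\<Prod>k. if k \<in> K then blaschke_factor (z k) w else 1) * h w"
      using LIMSEQ_subseq_LIMSEQ[OF blaschke_partial_products_tendsto[OF zK s w] h(3)] h(4)[OF w]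
      by (intro tendsto_mult) (simp_all only: o_def)
    have "?P (\<sigma> n) w * H (\<sigma> n) w = f w" for n using H w by simp
    then show "(\<lambda>n. ?P (\<sigma> n) w * H (\<sigma> n) w) \<longlonglongrightarrow> f w" by simp
  qed
  show ?thesis
  proof (rule that[of "\<lambda>w. cnj c * h w"])
    show "(\<lambda>w. cnj c * h w) holomorphic_on unit_disc" by (intro holomorphic_intros h)
    show "cmod (cnj c * h w) \<le> M" if "w \<in> unit_disc" for w using h(2)[OF that] c by (simp add: norm_mult)
    have "c * cnj c = 1" using complex_norm_square[of c] c by simp
    then show "f w = B w * (cnj c * h w)" if "w \<in> unit_disc" for w
      using fh[OF that] that unfolding Bc by (simp add: mult_ac)
  qed
qed

section \<open>The ideal\<close>

text \<open>Since \<open>Re G \<ge> 0\<close>, the positive part of \<open>log \<bar>exp G\<bar>\<close> is \<open>Re G\<close> itself.\<close>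

lemma exp_in_Np:
  assumes p: "0 < p" and G: "G holomorphic_on unit_disc" "\<And>w. w \<in> unit_disc \<Longrightarrow> 0 \<le> Re (G w)"
    and C: "\<And>r. r \<in> {0<..<1} \<Longrightarrow> integral {0..2*pi} (\<lambda>t. Re (G (of_real r * cis t)) powr p) \<le> C"
  shows "(\<lambda>w\<in>unit_disc. exp (G w)) \<in> Np_carrier p"
proof -
  have "log_plus_mean p (\<lambda>w\<in>unit_disc. exp (G w)) r \<le> C / (2 * pi)" if r: "r \<in> {0<..<1}" for r
  proof -
    have d: "of_real r * cis t \<in> unit_disc" for t using r by (simp add: norm_mult)
    have "log_plus_mean p (\<lambda>w\<in>unit_disc. exp (G w)) r = integral {0..2*pi} (\<lambda>t. Re (G (of_real r * cis t)) powr p / (2 * pi))"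
      unfolding log_plus_mean_def using d max_absorb1[OF G(2)[OF d]] by (simp add: log_plus_def)
    then show ?thesis using C[OF r] by (simp add: divide_right_mono)
  qed
  then have "bdd_above (log_plus_mean p (\<lambda>w\<in>unit_disc. exp (G w)) ` {0<..<1})"
    by (rule bdd_aboveI2)
  then show ?thesis unfolding Np_carrier_def
    by (auto intro!: holomorphic_on_restrict holomorphic_intros G)
qed

lemma Np_mult_closed:
  assumes "0 < p" "f \<in> Np_carrier p" "g \<in> Np_carrier p"
  shows "(\<lambda>w\<in>unit_disc. f w * g w) \<in> Np_carrier p"
proof -
  interpret cring "Np p" by (rule cring_Np[OF assms(1)])
  show ?thesis using m_closed[of f g] assms by (simp add: Np_def)
qed

lemma Np_ideal_linear_combination:
  assumes I: "ideal I (Np p)" and J: "finite J" "\<And>i. i \<in> J \<Longrightarrow> \<phi> i \<in> I" "\<And>i. i \<in> J \<Longrightarrow> c i \<in> Np_carrier p"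
  shows "(\<lambda>w\<in>unit_disc. \<Sum>i\<in>J. \<phi> i w * c i w) \<in> I"
  using J
proof (induction J rule: finite_induct)
  case empty
  then show ?case
    using additive_subgroup.zero_closed[OF ideal.axioms(1)[OF I]] by (simp add: Np_def restrict_def)
next
  case (insert i J)
  have "\<phi> i \<otimes>\<^bsub>Np p\<^esub> c i \<in> I"
    by (rule ideal.I_r_closed[OF I]) (use insert.prems in \<open>simp_all add: Np_def\<close>)
  then have "(\<phi> i \<otimes>\<^bsub>Np p\<^esub> c i) \<oplus>\<^bsub>Np p\<^esub> (\<lambda>w\<in>unit_disc. \<Sum>i\<in>J. \<phi> i w * c i w) \<in> I"
  proof (rule additive_subgroup.a_closed[OF ideal.axioms(1)[OF I]])
    show "(\<lambda>w\<in>unit_disc. \<Sum>i\<in>J. \<phi> i w * c i w) \<in> I"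
      by (rule insert.IH) (use insert.prems in auto)
  qed
  also have "(\<phi> i \<otimes>\<^bsub>Np p\<^esub> c i) \<oplus>\<^bsub>Np p\<^esub> (\<lambda>w\<in>unit_disc. \<Sum>i\<in>J. \<phi> i w * c i w)
      = (\<lambda>w\<in>unit_disc. \<Sum>i\<in>insert i J. \<phi> i w * c i w)"
    using insert.hyps by (auto simp: Np_def fun_eq_iff)
  finally show ?case .
qed

lemma exists_large_summand:
  fixes x :: "nat \<Rightarrow> real"
  assumes "1 \<le> n"
  shows "\<exists>i\<in>{1..n}. (\<Sum>i=1..n. x i) \<le> real n * x i"
proof (rule ccontr)
  assume "\<not> ?thesis"
  then have "(\<Sum>i=1..n. real n * x i) < (\<Sum>i=1..n. (\<Sum>i=1..n. x i))"
    using assms by (intro sum_strict_mono) (auto simp: not_le)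
  then show False by (simp add: sum_distrib_left)
qed

theorem theorem7:
  fixes p :: real and n :: nat and \<phi> :: "nat \<Rightarrow> complex \<Rightarrow> complex"
    and I :: "(complex \<Rightarrow> complex) set" and B :: "complex \<Rightarrow> complex"
    and K :: "nat set" and z :: "nat \<Rightarrow> complex"
  assumes "1 < p" and "1 \<le> n"
    and "\<And>i. i \<in> {1..n} \<Longrightarrow> inner_function (\<phi> i)"
    and "I = Idl\<^bsub>Np p\<^esub> (\<phi> ` {1..n})"
    and "interpolating_blaschke_product K z B" and "B \<in> I"
    and "\<And>k. k \<in> K \<Longrightarrow> (\<Sum>i=1..n. cmod (\<phi> i (z k))) > 0"
    and "(\<lambda>k. (1 - (cmod (z k))\<^sup>2) * \<bar>ln (\<Sum>i=1..n. cmod (\<phi> i (z k)))\<bar> powr p) summable_on K"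
  shows "I = carrier (Np p)"
proof -
  have p0: "0 < p" and p1: "1 \<le> p" using assms(1) by auto
  have B: "blaschke_product K z B" and z: "interpolating_sequence K z"
    using assms(5) unfolding interpolating_blaschke_product_def by (rule conjunct1, rule conjunct2)
  have zD: "z k \<in> unit_disc" if "k \<in> K" for k
    using interpolating_sequence_in_disc[OF z] that by blast
  have \<phi>: "\<phi> i \<in> Hinf" if "i \<in> {1..n}" for i
    using assms(3)[OF that] unfolding inner_function_def by (rule conjunct1)
  define S where "S k = (\<Sum>i=1..n. cmod (\<phi> i (z k)))" for k
  have S: "0 < S k" if "k \<in> K" for k unfolding S_def by (rule assms(7)[OF that])
  define a where "a k = \<bar>ln (S k)\<bar>" for k
  have wt: "0 \<le> (1 - (cmod (z k))\<^sup>2) * a k powr p" if "k \<in> K" for k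
    using zD[OF that] by (simp add: power_le_one)
  have A: "(\<Sum>k\<in>K \<inter> {..<N}. (1 - (cmod (z k))\<^sup>2) * a k powr p)
      \<le> infsum (\<lambda>k. (1 - (cmod (z k))\<^sup>2) * a k powr p) K" for N
    using assms(8) unfolding S_def[symmetric] a_def[symmetric]
    by (rule finite_sum_le_infsum) (use wt in auto)
  have a0: "0 \<le> a k" for k by (simp add: a_def)
  obtain G C where G: "G holomorphic_on unit_disc" "\<And>w. w \<in> unit_disc \<Longrightarrow> 0 \<le> Re (G w)"
    "\<And>k. k \<in> K \<Longrightarrow> a k - 1 \<le> Re (G (z k))"
    "\<And>r. r \<in> {0<..<1} \<Longrightarrow> integral {0..2*pi} (\<lambda>t. Re (G (of_real r * cis t)) powr p) \<le> C"
    by (rule positive_majorant[OF p1 z a0 A]) (rule that, assumption+)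
  have "\<forall>k. \<exists>i. i \<in> {1..n} \<and> S k \<le> real n * cmod (\<phi> i (z k))"
    using exists_large_summand[OF assms(2)] unfolding S_def by blast
  from choice[OF this] obtain \<iota> where \<iota>: "\<And>k. \<iota> k \<in> {1..n}" "\<And>k. S k \<le> real n * cmod (\<phi> (\<iota> k) (z k))"
    by blast
  have \<phi>\<iota>: "0 < cmod (\<phi> (\<iota> k) (z k))" if "k \<in> K" for k
    using S[OF that] \<iota>(2)[of k] by (cases "\<phi> (\<iota> k) (z k) = 0") auto
  (* The data are bounded: \<bar>exp (- G (z k))\<bar> \<le> exp (1 - a k) \<le> exp 1 * S k, since - \<bar>ln (S k)\<bar> \<le> ln (S k),
     and the chosen \<phi> i (z k) has modulus at least S k / n. *)
  define \<omega> where "\<omega> i k = (if i = \<iota> k then exp (- G (z k)) / \<phi> i (z k) else 0)" for i k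
  have \<omega>_bd: "cmod (\<omega> i k) \<le> exp 1 * real n" if k: "k \<in> K" for i k
  proof (cases "i = \<iota> k")
    case True
    have "exp (- Re (G (z k))) \<le> exp (1 + ln (S k))"
      using G(3)[OF k] by (simp add: a_def)
    also have "\<dots> = exp 1 * S k" using S[OF k] by (simp add: exp_add)
    also have "\<dots> \<le> exp 1 * (real n * cmod (\<phi> (\<iota> k) (z k)))" using \<iota>(2) by (intro mult_left_mono) auto
    finally show ?thesis using True \<phi>\<iota>[OF k] by (simp add: \<omega>_def norm_divide field_simps)
  qed (simp add: \<omega>_def)
  have "\<exists>f\<in>Hinf. \<forall>k\<in>K. f (z k) = \<omega> i k" for i
  proof -
    have "bounded (\<omega> i ` K)" unfolding bounded_iff using \<omega>_bd by blast
    then show ?thesis using z unfolding interpolating_sequence_def by (elim conjE allE[of _ "\<omega> i"]) (erule mp)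
  qed
  then have "\<forall>i. \<exists>f. f \<in> Hinf \<and> (\<forall>k\<in>K. f (z k) = \<omega> i k)" by blast
  from choice[OF this] obtain b where b: "\<And>i. b i \<in> Hinf" "\<And>i k. k \<in> K \<Longrightarrow> b i (z k) = \<omega> i k" by blast
  (* exp (- G) * (1 - (\<Sum>i. \<phi> i * c i)) for c i = exp G * b i *)
  define F where "F w = exp (- G w) - (\<Sum>i=1..n. \<phi> i w * b i w)" for w
  have hol: "F holomorphic_on unit_disc"
    unfolding F_def[abs_def] using \<phi> b(1) by (intro holomorphic_intros G) (auto simp: Hinf_def)
  have Fz: "F (z k) = 0" if k: "k \<in> K" for k
  proof -
    have "(\<Sum>i=1..n. \<phi> i (z k) * b i (z k)) = (\<Sum>i=1..n. if i = \<iota> k then exp (- G (z k)) else 0)"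
      using b(2)[OF k] \<phi>\<iota>[OF k] by (intro sum.cong) (auto simp: \<omega>_def)
    also have "\<dots> = exp (- G (z k))" using \<iota>(1)[of k] by (simp add: sum.delta')
    finally show ?thesis by (simp add: F_def)
  qed
  have "\<exists>M. \<forall>w\<in>unit_disc. cmod (h w) \<le> M" if "h \<in> Hinf" for h
    using that unfolding Hinf_def bounded_iff by blast
  then obtain M where M: "\<And>h w. h \<in> Hinf \<Longrightarrow> w \<in> unit_disc \<Longrightarrow> cmod (h w) \<le> M h" by metis
  have F_bd: "cmod (F w) \<le> 1 + (\<Sum>i=1..n. M (\<phi> i) * M (b i))" if w: "w \<in> unit_disc" for w
  proof -
    have "cmod (F w) \<le> cmod (exp (- G w)) + cmod (\<Sum>i=1..n. \<phi> i w * b i w)"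
      unfolding F_def by (rule norm_triangle_ineq4)
    also have "cmod (exp (- G w)) \<le> 1" using G(2)[OF w] by simp
    also have "cmod (\<Sum>i=1..n. \<phi> i w * b i w) \<le> (\<Sum>i=1..n. M (\<phi> i) * M (b i))"
    proof (rule sum_norm_le)
      fix i assume i: "i \<in> {1..n}"
      have "0 \<le> M (\<phi> i)" by (rule order_trans[OF norm_ge_zero M[OF \<phi>[OF i] w]])
      then show "cmod (\<phi> i w * b i w) \<le> M (\<phi> i) * M (b i)"
        unfolding norm_mult using M[OF \<phi>[OF i] w] M[OF b(1) w] by (intro mult_mono) auto
    qed
    finally show ?thesis by simp
  qed
  obtain h where h: "h holomorphic_on unit_disc" "\<And>w. w \<in> unit_disc \<Longrightarrow> cmod (h w) \<le> 1 + (\<Sum>i=1..n. M (\<phi> i) * M (b i))"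
    "\<And>w. w \<in> unit_disc \<Longrightarrow> F w = B w * h w"
    by (rule divide_blaschke_product[of F _ K z B, OF hol _ B interpolating_sequence_inj_on[OF z]])
      (erule F_bd, erule Fz, rule that, assumption+)
  have h_in: "(\<lambda>w\<in>unit_disc. h w) \<in> Hinf"
  proof -
    have "bounded (h ` unit_disc)" unfolding bounded_iff using h(2) by blast
    then show ?thesis using holomorphic_on_restrict[OF h(1)] by (simp add: Hinf_def)
  qed
  define E where "E = (\<lambda>w\<in>unit_disc. exp (G w))"
  have E: "E \<in> Np_carrier p" unfolding E_def by (rule exp_in_Np[OF p0 G(1,2,4)])
  have Hinf_Np: "f \<in> Np_carrier p" if "f \<in> Hinf" for f using Hinf_subset_Np_carrier[OF p0] that by blast
  interpret cring "Np p" by (rule cring_Np[OF p0])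
  have gens: "\<phi> ` {1..n} \<subseteq> carrier (Np p)" using \<phi> Hinf_Np by (auto simp: Np_def)
  have ideal_I: "ideal I (Np p)" unfolding assms(4) by (rule genideal_ideal[OF gens])
  have \<phi>I: "\<phi> i \<in> I" if "i \<in> {1..n}" for i
    unfolding assms(4) using genideal_self[OF gens] that by blast
  define c where "c i = (\<lambda>w\<in>unit_disc. E w * b i w)" for i
  define d where "d = (\<lambda>w\<in>unit_disc. E w * (\<lambda>w\<in>unit_disc. h w) w)"
  have c: "c i \<in> Np_carrier p" for i unfolding c_def by (intro Np_mult_closed p0 E Hinf_Np b)
  have d: "d \<in> Np_carrier p" unfolding d_def by (intro Np_mult_closed p0 E Hinf_Np h_in)
  have "(\<lambda>w\<in>unit_disc. \<Sum>i=1..n. \<phi> i w * c i w) \<in> I"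
    by (rule Np_ideal_linear_combination[OF ideal_I]) (use \<phi>I c in auto)
  moreover have "B \<otimes>\<^bsub>Np p\<^esub> d \<in> I"
    by (rule ideal.I_r_closed[OF ideal_I assms(6)]) (simp add: Np_def d)
  ultimately have "(\<lambda>w\<in>unit_disc. \<Sum>i=1..n. \<phi> i w * c i w) \<oplus>\<^bsub>Np p\<^esub> (B \<otimes>\<^bsub>Np p\<^esub> d) \<in> I"
    by (rule additive_subgroup.a_closed[OF ideal.axioms(1)[OF ideal_I]])
  moreover have "(\<lambda>w\<in>unit_disc. \<Sum>i=1..n. \<phi> i w * c i w) \<oplus>\<^bsub>Np p\<^esub> (B \<otimes>\<^bsub>Np p\<^esub> d) = \<one>\<^bsub>Np p\<^esub>"
  proof -
    have "(\<Sum>i=1..n. \<phi> i w * c i w) + B w * d w = 1" if w: "w \<in> unit_disc" for w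
    proof -
      have "(\<Sum>i=1..n. \<phi> i w * c i w) + B w * d w = exp (G w) * ((\<Sum>i=1..n. \<phi> i w * b i w) + B w * h w)"
        using w by (simp add: c_def d_def E_def sum_distrib_left distrib_left mult_ac)
      also have "\<dots> = exp (G w) * exp (- G w)" unfolding h(3)[OF w, symmetric] F_def by simp
      finally show ?thesis by (simp add: exp_minus)
    qed
    then show ?thesis by (auto simp: Np_def fun_eq_iff)
  qed
  ultimately have "\<one>\<^bsub>Np p\<^esub> \<in> I" by simp
  then show ?thesis by (rule ideal.one_imp_carrier[OF ideal_I])
qed

end
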